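(* There exist a $\sigma$-finite measure space $(\mathcal{X},\mathcal{E},\mu)$, a Poisson process $N$ with intensity $\mu$ on some probability space $(\Omega,\mathcal{A},P)$, a real number $\delta>0$, and a sequence $(F_n)_{n\in\mathbb{N}}$ of random variables in $T_2=\mathcal{I}_0\oplus\mathcal{I}_1\oplus\mathcal{I}_2$ (where $\mathcal{I}_p$ is the $p$-th Poisson-Wiener chaos of $N$) such that $$F_n\to 0 \text{ almost surely},\qquad F_n\to 0 \text{ in } L_{2+\delta},\qquad E\Big\{\sup_n |F_n|^{\delta}\Big\}<\infty,$$ but $J_1(F_n)$ does not converge to $0$ almost surely, where $J_1$ is the orthogonal projection onto $\mathcal{I}_1$.
   Context: Let $(\mathcal{X},\mathcal{E},\mu)$ be a $\sigma$-finite measure space. A Poisson process $N$ with intensity $\mu$ is a random measure on $(\mathcal{X},\mathcal{E})$ with values in $\{0,1,2,\dots\}\cup\{\infty\}$ such that $N(A)$ is Poisson distributed with parameter $\mu(A)$ for every $A\in\mathcal{E}$ with $\mu(A)<\infty$, and $N(A_1),\dots,N(A_k)$ are independent whenever $A_1,\dots,A_k\in\mathcal{E}$ are pairwise disjoint. The Poisson-Wiener chaoses of order $p=0,1,2$ are defined as follows. $\mathcal{I}_0$ is the set of constants. For $p\in\{1,2\}$, $\mathcal{I}_p$ is the set of all random variables $I_p(f)$, where $f$ ranges over the symmetric elements of $L_2(\mathcal{X}^p,\mathcal{E}^p,\mu^p)$ and $I_p$ is the multiple Poisson integral of order $p$. For symmetric $f\in L_1(\mu^p)\cap L_2(\mu^p)$,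 it is given by $$I_1(f)=\int f\,dN-\int f\,d\mu,$$ $$I_2(f)=\Big[\int\!\!\int f(x,y)\,N(dx)N(dy)-\int f(x,x)\,N(dx)\Big]-2\int\!\!\int f(x,y)\,N(dx)\mu(dy)+\int\!\!\int f\,d\mu^2,$$ and it is extended to all symmetric $f\in L_2(\mu^p)$ by continuity through the isometry $E\{I_p(f)^2\}=p!\int f^2\,d\mu^p$. In particular, for disjoint $A,B\in\mathcal{E}$ of finite $\mu$-measure, $I_2\big(1_A(x)1_B(y)+1_B(x)1_A(y)\big)=2\,(N(A)-\mu(A))(N(B)-\mu(B))$. The $\mathcal{I}_p$ are pairwise orthogonal closed subspaces of $L_2(\Omega,\sigma(N),P)$, and $J_p$ denotes the orthogonal projection of $L_2(\Omega,\sigma(N),P)$ onto $\mathcal{I}_p$. *)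

theory Defs
  imports "HOL-Probability.Probability"
begin

definition L2 :: "'a measure \<Rightarrow> ('a \<Rightarrow> real) set" where
  "L2 M = {f \<in> borel_measurable M. integrable M (\<lambda>x. (f x)\<^sup>2)}"

definition L2_tendsto :: "'a measure \<Rightarrow> (nat \<Rightarrow> 'a \<Rightarrow> real) \<Rightarrow> ('a \<Rightarrow> real) \<Rightarrow> bool" where
  "L2_tendsto M f g \<longleftrightarrow> (\<lambda>k. \<integral>x. (f k x - g x)\<^sup>2 \<partial>M) \<longlonglongrightarrow> 0"

text \<open>Random variables are functions rather than classes modulo null sets. Hence the multiple
  integrals and the projections below are relations that single out all \<open>\<sigma>(N)\<close>-measurable versions,
  and the chaoses are sets containing, with a function, all its \<open>\<sigma>(N)\<close>-measurable versions.\<close>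

locale poisson_process = prob_space M + mu: sigma_finite_measure mu
  for M :: "'w measure" and mu :: "'x measure" +
  fixes N :: "'w \<Rightarrow> 'x measure"
  assumes sets_N: "\<And>w. w \<in> space M \<Longrightarrow> sets (N w) = sets mu"
    and measurable_N: "\<And>A. A \<in> sets mu \<Longrightarrow> (\<lambda>w. emeasure (N w) A) \<in> borel_measurable M"
    and N_values: "\<And>w A. w \<in> space M \<Longrightarrow> A \<in> sets mu \<Longrightarrow>
      emeasure (N w) A \<in> insert \<infinity> (range of_nat)"
    and N_poisson: "\<And>A k. A \<in> sets mu \<Longrightarrow> emeasure mu A < \<infinity> \<Longrightarrow>
      prob {w \<in> space M. emeasure (N w) A = of_nat k}
        = exp (- measure mu A) * measure mu A ^ k / fact k"
    and N_indep: "\<And>(A :: nat \<Rightarrow> 'x set) k. (\<And>i. i < k \<Longrightarrow> A i \<in> sets mu) \<Longrightarrow>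
      disjoint_family_on A {..<k} \<Longrightarrow>
      indep_vars (\<lambda>_. borel) (\<lambda>i w. emeasure (N w) (A i)) {..<k}"
begin

definition sigma_N :: "'w measure" where
  "sigma_N = sigma (space M)
     {(\<lambda>w. emeasure (N w) A) -` B \<inter> space M | A B. A \<in> sets mu \<and> B \<in> sets borel}"

definition L2_N :: "('w \<Rightarrow> real) set" where
  "L2_N = L2 M \<inter> borel_measurable sigma_N"

definition sym_fun :: "('x \<times> 'x \<Rightarrow> real) \<Rightarrow> bool" where
  "sym_fun f \<longleftrightarrow> (\<forall>x\<in>space mu. \<forall>y\<in>space mu. f (x, y) = f (y, x))"

definition I1_formula :: "('x \<Rightarrow> real) \<Rightarrow> 'w \<Rightarrow> real" where
  "I1_formula f w = (\<integral>x. f x \<partial>N w) - (\<integral>x. f x \<partial>mu)"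

text \<open>The first summand is the difference of \<open>\<integral>\<integral> f(x,y) N(dx) N(dy)\<close> and \<open>\<integral> f(y,y) N(dy)\<close>, taken
  under one outer integral: for \<open>f \<in> L\<^sub>1(\<mu>\<^sup>2)\<close> it is almost surely finite, whereas each of the two
  terms may diverge on its own, as integrability of \<open>f\<close> does not control its diagonal.\<close>

definition I2_formula :: "('x \<times> 'x \<Rightarrow> real) \<Rightarrow> 'w \<Rightarrow> real" where
  "I2_formula f w =
     (\<integral>y. ((\<integral>x. f (x, y) \<partial>N w) - f (y, y)) \<partial>N w)
     - 2 * (\<integral>y. (\<integral>x. f (x, y) \<partial>N w) \<partial>mu)
     + (\<integral>z. f z \<partial>(mu \<Otimes>\<^sub>M mu))"

text \<open>\<open>L2_extension Q D I f X\<close>: \<open>X\<close> is a version of the value at \<open>f \<in> L\<^sub>2(Q)\<close> of the extension by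
  continuity of \<open>I\<close>, given almost surely on \<open>D\<close>.\<close>

definition L2_extension ::
  "'y measure \<Rightarrow> ('y \<Rightarrow> real) set \<Rightarrow> (('y \<Rightarrow> real) \<Rightarrow> 'w \<Rightarrow> real) \<Rightarrow>
   ('y \<Rightarrow> real) \<Rightarrow> ('w \<Rightarrow> real) \<Rightarrow> bool" where
  "L2_extension Q D I f X \<longleftrightarrow> f \<in> L2 Q \<and> X \<in> L2_N \<and>
     (\<exists>g Y. (\<forall>k. g k \<in> D \<and> Y k \<in> L2_N \<and> (AE w in M. Y k w = I (g k) w)) \<and>
            L2_tendsto Q g f \<and> L2_tendsto M Y X)"

definition is_I1 :: "('x \<Rightarrow> real) \<Rightarrow> ('w \<Rightarrow> real) \<Rightarrow> bool" where
  "is_I1 = L2_extension mu {f \<in> L2 mu. integrable mu f} I1_formula"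

definition is_I2 :: "('x \<times> 'x \<Rightarrow> real) \<Rightarrow> ('w \<Rightarrow> real) \<Rightarrow> bool" where
  "is_I2 = L2_extension (mu \<Otimes>\<^sub>M mu)
     {f \<in> L2 (mu \<Otimes>\<^sub>M mu). integrable (mu \<Otimes>\<^sub>M mu) f \<and> sym_fun f} I2_formula"

definition chaos0 :: "('w \<Rightarrow> real) set" where
  "chaos0 = {X \<in> L2_N. \<exists>c. AE w in M. X w = c}"

definition chaos1 :: "('w \<Rightarrow> real) set" where
  "chaos1 = {X. \<exists>f\<in>L2 mu. is_I1 f X}"

definition chaos2 :: "('w \<Rightarrow> real) set" where
  "chaos2 = {X. \<exists>f\<in>L2 (mu \<Otimes>\<^sub>M mu). sym_fun f \<and> is_I2 f X}"

definition T2 :: "('w \<Rightarrow> real) set" where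
  "T2 = {F \<in> L2_N. \<exists>X0\<in>chaos0. \<exists>X1\<in>chaos1. \<exists>X2\<in>chaos2.
           AE w in M. F w = X0 w + X1 w + X2 w}"

definition is_orth_proj :: "('w \<Rightarrow> real) set \<Rightarrow> ('w \<Rightarrow> real) \<Rightarrow> ('w \<Rightarrow> real) \<Rightarrow> bool" where
  "is_orth_proj V F G \<longleftrightarrow> F \<in> L2_N \<and> G \<in> V \<and> (\<forall>H\<in>V. (\<integral>w. (F w - G w) * H w \<partial>M) = 0)"

definition is_J1 :: "('w \<Rightarrow> real) \<Rightarrow> ('w \<Rightarrow> real) \<Rightarrow> bool" where
  "is_J1 = is_orth_proj chaos1"

end

end

theory Submission imports Defs begin

text \<open>Let \<open>A\<^sub>n\<close>, \<open>B\<^sub>n\<close> be disjoint sets of measures \<open>\<epsilon>\<^sub>n = 1/(n+1)\<close> and \<open>\<beta>\<^sub>n = \<epsilon>\<^sub>n powr (1/2)\<close>, and put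
  \<open>F\<^sub>n = (N(A\<^sub>n) - \<epsilon>\<^sub>n) N(B\<^sub>n) / \<beta>\<^sub>n = (N(A\<^sub>n) - \<epsilon>\<^sub>n) + (N(A\<^sub>n) - \<epsilon>\<^sub>n) (N(B\<^sub>n) - \<beta>\<^sub>n) / \<beta>\<^sub>n\<close>, whose
  components in the first and second chaos are the two summands. Since \<open>\<Sum> \<epsilon>\<^sub>n = \<infinity>\<close>, infinitely many
  of the independent variables \<open>N(A\<^sub>n)\<close> are nonzero, so \<open>J\<^sub>1(F\<^sub>n) = N(A\<^sub>n) - \<epsilon>\<^sub>n\<close> does not tend to 0. But
  \<open>\<Sum> \<epsilon>\<^sub>n \<beta>\<^sub>n < \<infinity>\<close>, so the factor \<open>N(B\<^sub>n)\<close> kills \<open>F\<^sub>n\<close> almost always when \<open>N(A\<^sub>n) \<noteq> 0\<close>, and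
  \<open>E|F\<^sub>n| powr (5/2)\<close> is of order \<open>\<epsilon>\<^sub>n \<beta>\<^sub>n powr (-3/2) \<longlonglongrightarrow> 0\<close>; thus \<open>\<delta> = 1/2\<close> works. Only countably
  many disjoint sets matter, so \<open>\<mu>\<close> can be purely atomic and \<open>N\<close> a sequence of independent Poisson
  variables.\<close>

section \<open>Purely atomic measures with atoms at the natural numbers of the real line\<close>

text \<open>One construction serves twice: with deterministic weights it is the intensity, with
  random counts as weights it is a realisation of the process. The integral formulas below therefore
  apply to both.\<close>

definition atoms :: "(nat \<Rightarrow> real) \<Rightarrow> real measure" where
  "atoms v = distr (density (count_space UNIV) (\<lambda>i. ennreal (v i))) borel real"

lemma sets_atoms [simp, measurable_cong]: "sets (atoms v) = sets borel"
  by (simp add: atoms_def)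

lemma space_atoms [simp]: "space (atoms v) = UNIV"
  by (simp add: atoms_def)

lemma emeasure_atoms:
  assumes "A \<in> sets borel"
  shows "emeasure (atoms v) A = (\<Sum>i. ennreal (v i) * indicator A (real i))"
proof -
  have "emeasure (atoms v) A = emeasure (density (count_space UNIV) (\<lambda>i. ennreal (v i))) (real -` A)"
    using assms by (simp add: atoms_def emeasure_distr)
  also have "\<dots> = (\<Sum>i. ennreal (v i) * indicator (real -` A) i)"
    by (subst emeasure_density) (simp_all add: nn_integral_count_space_nat)
  finally show ?thesis
    by (simp add: indicator_def vimage_def)
qed

lemma emeasure_atoms_singleton: "emeasure (atoms v) {real a} = ennreal (v a)"
proof -
  have "emeasure (atoms v) {real a} = (\<Sum>i. ennreal (v i) * indicator {real a} (real i))"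
    by (intro emeasure_atoms) auto
  also have "\<dots> = (\<Sum>i\<in>{a}. ennreal (v i) * indicator {real a} (real i))"
    by (intro suminf_finite) auto
  finally show ?thesis by simp
qed

lemma measure_atoms_singleton: "v a \<ge> 0 \<Longrightarrow> measure (atoms v) {real a} = v a"
  by (simp add: measure_def emeasure_atoms_singleton)

lemma integrable_indicator_atoms:
  "integrable (atoms v) (indicator {real a} :: real \<Rightarrow> real)"
  by (intro integrable_real_indicator) (auto simp: emeasure_atoms_singleton)

lemma integrable_atoms_iff:
  fixes g :: "real \<Rightarrow> real"
  assumes [measurable]: "g \<in> borel_measurable borel" and "\<And>i. v i \<ge> 0"
  shows "integrable (atoms v) g \<longleftrightarrow> summable (\<lambda>i. v i * \<bar>g (real i)\<bar>)"
proof -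
  have "integrable (atoms v) g \<longleftrightarrow> integrable (density (count_space UNIV) (\<lambda>i. ennreal (v i))) (\<lambda>i. g (real i))"
    unfolding atoms_def by (subst integrable_distr_eq) auto
  also have "\<dots> \<longleftrightarrow> summable (\<lambda>i. v i * \<bar>g (real i)\<bar>)"
    using assms by (subst integrable_density)
      (auto simp: integrable_count_space_nat_iff abs_mult)
  finally show ?thesis .
qed

lemma integral_atoms:
  fixes g :: "real \<Rightarrow> real"
  assumes [measurable]: "g \<in> borel_measurable borel" and "\<And>i. v i \<ge> 0"
    and "summable (\<lambda>i. v i * \<bar>g (real i)\<bar>)"
  shows "(\<integral>x. g x \<partial>atoms v) = (\<Sum>i. v i * g (real i))"
proof -
  have "(\<integral>x. g x \<partial>atoms v) = (\<integral>i. g (real i) \<partial>density (count_space UNIV) (\<lambda>i. ennreal (v i)))"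
    unfolding atoms_def by (subst integral_distr) auto
  also have "\<dots> = (\<integral>i. v i * g (real i) \<partial>count_space UNIV)"
    using assms by (subst integral_density) auto
  also have "\<dots> = (\<Sum>i. v i * g (real i))"
    using assms by (intro integral_count_space_nat)
      (auto simp: integrable_count_space_nat_iff abs_mult)
  finally show ?thesis .
qed

text \<open>All atoms sit at natural numbers, so a half-line bounded above contains only finitely
  many of them and has finite measure.\<close>

lemma sigma_finite_atoms: "sigma_finite_measure (atoms v)"
proof
  have "(\<Union>n::nat. {..<real n}) = UNIV"
    by (auto intro: reals_Archimedean2)
  moreover have "emeasure (atoms v) {..<real n} \<noteq> \<infinity>" for n :: nat
  proof -
    have "emeasure (atoms v) {..<real n} = (\<Sum>i. ennreal (v i) * indicator {..<real n} (real i))"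
      by (intro emeasure_atoms) auto
    also have "\<dots> = (\<Sum>i<n. ennreal (v i) * indicator {..<real n} (real i))"
      by (intro suminf_finite) auto
    also have "\<dots> < \<infinity>"
      by (auto simp: ennreal_mult_less_top indicator_def)
    finally show ?thesis by simp
  qed
  ultimately show "\<exists>A. countable A \<and> A \<subseteq> sets (atoms v) \<and> \<Union> A = space (atoms v) \<and>
      (\<forall>a\<in>A. emeasure (atoms v) a \<noteq> \<infinity>)"
    by (intro exI[of _ "range (\<lambda>n::nat. {..<real n})"]) auto
qed

section \<open>Moments of the Poisson distribution\<close>

lemma nn_integral_poisson_pmf:
  assumes "l > 0"
  shows "(\<integral>\<^sup>+k. h k \<partial>measure_pmf (poisson_pmf l)) = (\<Sum>k. ennreal (l ^ k / fact k * exp (- l)) * h k)"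
  using assms by (simp add: nn_integral_measure_pmf nn_integral_count_space_nat)

text \<open>The Chen-Stein identity: the weights satisfy (k + 1) p(k + 1) = l p(k), and the term k =
  0 vanishes. Taking powers for \<open>h\<close> yields the moments recursively.\<close>

lemma nn_integral_poisson_pmf_of_nat_mult:
  assumes "l > 0"
  shows "(\<integral>\<^sup>+k. of_nat k * h k \<partial>measure_pmf (poisson_pmf l)) =
    ennreal l * (\<integral>\<^sup>+k. h (Suc k) \<partial>measure_pmf (poisson_pmf l))"
proof -
  have eq: "ennreal (l ^ Suc k / fact (Suc k) * exp (- l)) * (of_nat (Suc k) * h (Suc k)) =
      ennreal l * (ennreal (l ^ k / fact k * exp (- l)) * h (Suc k))" for k
  proof -
    have "ennreal (l ^ Suc k / fact (Suc k) * exp (- l)) * of_nat (Suc k) =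
        ennreal (l ^ Suc k / fact (Suc k) * exp (- l) * real (Suc k))"
      using assms by (subst ennreal_mult) (simp_all add: ennreal_of_nat_eq_real_of_nat del: of_nat_Suc power_Suc fact_Suc)
    also have "l ^ Suc k / fact (Suc k) * exp (- l) * real (Suc k) = l * (l ^ k / fact k * exp (- l))"
      by (simp add: divide_simps)
    also have "ennreal \<dots> = ennreal l * ennreal (l ^ k / fact k * exp (- l))"
      using assms by (intro ennreal_mult) auto
    finally show ?thesis
      by (simp only: mult.assoc [symmetric])
  qed
  have "(\<integral>\<^sup>+k. of_nat k * h k \<partial>measure_pmf (poisson_pmf l)) =
      (\<Sum>k. ennreal (l ^ k / fact k * exp (- l)) * (of_nat k * h k))"
    using assms by (simp add: nn_integral_poisson_pmf)
  also have "\<dots> = (\<Sum>k. ennreal (l ^ Suc k / fact (Suc k) * exp (- l)) * (of_nat (Suc k) * h (Suc k)))"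
    using suminf_offset[of "\<lambda>k. ennreal (l ^ k / fact k * exp (- l)) * (of_nat k * h k)" 1]
    by (simp del: fact_Suc power_Suc of_nat_Suc)
  also have "\<dots> = ennreal l * (\<Sum>k. ennreal (l ^ k / fact k * exp (- l)) * h (Suc k))"
    unfolding eq by simp
  finally show ?thesis
    using assms by (simp add: nn_integral_poisson_pmf)
qed

lemma nn_integral_poisson_pmf_of_nat:
  assumes "l > 0"
  shows "(\<integral>\<^sup>+k. of_nat k \<partial>measure_pmf (poisson_pmf l)) = ennreal l"
  using nn_integral_poisson_pmf_of_nat_mult[OF assms, of "\<lambda>_. 1"] by simp

lemma nn_integral_poisson_pmf_of_nat_power2:
  assumes "l > 0"
  shows "(\<integral>\<^sup>+k. (of_nat k)\<^sup>2 \<partial>measure_pmf (poisson_pmf l)) = ennreal (l * (l + 1))"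
proof -
  have "(\<integral>\<^sup>+k. (of_nat k :: ennreal)\<^sup>2 \<partial>measure_pmf (poisson_pmf l)) =
      ennreal l * (\<integral>\<^sup>+k. of_nat k + 1 \<partial>measure_pmf (poisson_pmf l))"
    using nn_integral_poisson_pmf_of_nat_mult[OF assms, of of_nat]
    by (simp add: power2_eq_square add.commute)
  also have "(\<integral>\<^sup>+k. of_nat k + 1 \<partial>measure_pmf (poisson_pmf l)) = ennreal (l + 1)"
    using assms by (subst nn_integral_add) (auto simp: nn_integral_poisson_pmf_of_nat)
  finally show ?thesis
    using assms by (simp add: ennreal_mult)
qed

lemma nn_integral_poisson_pmf_of_nat_power3:
  assumes "l > 0"
  shows "(\<integral>\<^sup>+k. (of_nat k) ^ 3 \<partial>measure_pmf (poisson_pmf l)) = ennreal (l * (l * (l + 1) + 2 * l + 1))"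
proof -
  have sq: "(1 + x)\<^sup>2 = x\<^sup>2 + (2 * x + 1)" for x :: ennreal
    by (simp add: power2_eq_square distrib_left distrib_right mult_2 add.assoc)
  have "(\<integral>\<^sup>+k. (of_nat k :: ennreal) ^ 3 \<partial>measure_pmf (poisson_pmf l)) =
      ennreal l * (\<integral>\<^sup>+k. (of_nat k)\<^sup>2 + (2 * of_nat k + 1) \<partial>measure_pmf (poisson_pmf l))"
    using nn_integral_poisson_pmf_of_nat_mult[OF assms, of "\<lambda>k. (of_nat k)\<^sup>2"]
    by (simp add: power2_eq_square power3_eq_cube sq[unfolded power2_eq_square] mult.assoc)
  also have "(\<integral>\<^sup>+k. (of_nat k)\<^sup>2 + (2 * of_nat k + 1) \<partial>measure_pmf (poisson_pmf l)) =
      ennreal (l * (l + 1)) + (2 * ennreal l + 1)"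
    using assms by (subst nn_integral_add, simp, simp)+ (simp add: nn_integral_cmult
      nn_integral_poisson_pmf_of_nat nn_integral_poisson_pmf_of_nat_power2)
  also have "\<dots> = ennreal (l * (l + 1) + 2 * l + 1)"
    using assms by (simp add: ennreal_mult ac_simps)
  finally show ?thesis
    using assms by (simp add: ennreal_mult)
qed

section \<open>Independent Poisson counts and their sums\<close>

text \<open>\<open>c i\<close> will be the multiplicity of the atom at \<open>real i\<close>. Strict
  positivity of the rates also justifies the divisions by \<open>lam b\<close> further down.\<close>

locale indep_poisson = prob_space M
  for M :: "'w measure" +
  fixes lam :: "nat \<Rightarrow> real" and c :: "nat \<Rightarrow> 'w \<Rightarrow> nat"
  assumes lam_pos: "\<And>i. lam i > 0"
    and indep_c: "indep_vars (\<lambda>_. count_space UNIV) c UNIV"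
    and distr_c: "\<And>i. distr M (count_space UNIV) (c i) = measure_pmf (poisson_pmf (lam i))"
begin

lemma lam_nonneg [simp]: "0 \<le> lam i"
  using lam_pos[of i] by simp

lemma measurable_c [measurable]: "c i \<in> measurable M (count_space UNIV)"
  using indep_c by (auto simp: indep_vars_def)

lemma nn_integral_c:
  "(\<integral>\<^sup>+w. h (c i w) \<partial>M) = (\<integral>\<^sup>+k. h k \<partial>measure_pmf (poisson_pmf (lam i)))"
  by (subst distr_c [symmetric], subst nn_integral_distr) auto

lemma prob_c: "prob {w \<in> space M. c i w = k} = exp (- lam i) * lam i ^ k / fact k"
proof -
  have "prob {w \<in> space M. c i w = k} = measure (distr M (count_space UNIV) (c i)) {k}"
    by (subst measure_distr) (auto intro!: arg_cong[where f = prob])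
  also have "\<dots> = pmf (poisson_pmf (lam i)) k"
    unfolding distr_c by (simp add: pmf.rep_eq)
  finally show ?thesis
    using lam_pos[of i] by simp
qed

lemma indep_c_compose:
  "(\<And>i. h i \<in> borel_measurable (count_space UNIV)) \<Longrightarrow> indep_vars (\<lambda>_. borel) (\<lambda>i w. h i (c i w)) J"
  by (rule indep_vars_compose2 [OF indep_vars_subset [OF indep_c]]) auto

text \<open>Splitting according to the value of the new summand gives, by independence, a
  convolution of two Poisson weights, which the binomial theorem sums.\<close>

lemma prob_sum_c:
  assumes "finite J"
  shows "prob {w \<in> space M. (\<Sum>j\<in>J. c j w) = k} =
    exp (- (\<Sum>j\<in>J. lam j)) * (\<Sum>j\<in>J. lam j) ^ k / fact k"
  using assms
proof (induction J arbitrary: k)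
  case empty
  then show ?case by (cases k) (auto simp: prob_space)
next
  case (insert x J)
  define S where "S w = (\<Sum>j\<in>J. c j w)" for w
  define L where "L = (\<Sum>j\<in>J. lam j)"
  have [measurable]: "S \<in> measurable M (count_space UNIV)"
    unfolding S_def by measurable
  have "indep_vars (\<lambda>_. borel) (\<lambda>i w. real (c i w)) (insert x J)"
    by (rule indep_c_compose) auto
  then have "indep_var borel (\<lambda>w. real (c x w)) borel (\<lambda>w. \<Sum>i\<in>J. real (c i w))"
    using insert by (intro indep_vars_sum)
  then have ind: "indep_var borel (\<lambda>w. real (c x w)) borel (\<lambda>w. real (S w))"
    by (simp add: S_def)
  have prod: "prob {w \<in> space M. c x w = i \<and> S w = j} =
      prob {w \<in> space M. c x w = i} * prob {w \<in> space M. S w = j}" for i j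
    using prob_indep_random_variable[OF ind, of "{real i}" "{real j}"] by simp
  have "{w \<in> space M. (\<Sum>j\<in>insert x J. c j w) = k} =
      (\<Union>i\<in>{..k}. {w \<in> space M. c x w = i \<and> S w = k - i})"
    using insert by (auto simp: S_def)
  then have "prob {w \<in> space M. (\<Sum>j\<in>insert x J. c j w) = k} =
      (\<Sum>i\<le>k. prob {w \<in> space M. c x w = i \<and> S w = k - i})"
    by (simp only:) (intro finite_measure_finite_Union, auto simp: disjoint_family_on_def)
  \<comment> \<open>Writing the reciprocal factorials as scalars brings the sum into the shape of
    \<open>exp_series_add_commuting\<close>, the binomial theorem for divided powers.\<close>
  also have "\<dots> = (\<Sum>i\<le>k. (exp (- lam x) * exp (- L)) * ((lam x ^ i /\<^sub>R fact i) * (L ^ (k - i) /\<^sub>R fact (k - i))))"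
    unfolding prod prob_c by (simp add: S_def insert.IH L_def field_simps)
  also have "\<dots> = (exp (- lam x) * exp (- L)) * ((lam x + L) ^ k /\<^sub>R fact k)"
    using exp_series_add_commuting[of "lam x" L k]
    by (simp add: sum_distrib_left [symmetric] mult.commute)
  also have "\<dots> = exp (- (\<Sum>j\<in>insert x J. lam j)) * (\<Sum>j\<in>insert x J. lam j) ^ k / fact k"
    using insert by (simp add: L_def mult_exp_exp field_simps)
  finally show ?case .
qed

end

section \<open>The Poisson process made of the counts at the atoms\<close>

text \<open>Terms of a convergent series tend to 0, and a natural number below 1 is 0. For the
  process this is the dichotomy that a set has infinitely many points or meets only finitely many
  occupied atoms.\<close>

lemma suminf_of_nat_eq_top_or_finite_support:
  fixes f :: "nat \<Rightarrow> nat"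
  shows "(\<Sum>i. of_nat (f i) :: ennreal) = \<infinity> \<or> (\<exists>n. \<forall>i\<ge>n. f i = 0)"
proof (rule disjCI)
  assume "\<not> (\<exists>n. \<forall>i\<ge>n. f i = 0)"
  then have *: "\<And>n. \<exists>i\<ge>n. f i \<noteq> 0" by blast
  show "(\<Sum>i. of_nat (f i) :: ennreal) = \<infinity>"
  proof (rule ccontr)
    assume "(\<Sum>i. of_nat (f i) :: ennreal) \<noteq> \<infinity>"
    then have "summable (\<lambda>i. real (f i))"
      by (intro summable_suminf_not_top) (auto simp: ennreal_of_nat_eq_real_of_nat)
    then have "(\<lambda>i. real (f i)) \<longlonglongrightarrow> 0"
      by (rule summable_LIMSEQ_zero)
    then have "\<forall>\<^sub>F i in sequentially. real (f i) < 1"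
      by (rule order_tendstoD) simp
    then obtain n where "\<And>i. i \<ge> n \<Longrightarrow> real (f i) < 1"
      unfolding eventually_sequentially by blast
    with *[of n] show False by force
  qed
qed

context indep_poisson
begin

definition proc :: "'w \<Rightarrow> real measure" where
  "proc w = atoms (\<lambda>i. real (c i w))"

lemma emeasure_proc:
  assumes "A \<in> sets borel"
  shows "emeasure (proc w) A = (\<Sum>i. of_nat (if real i \<in> A then c i w else 0))"
  unfolding proc_def
  by (subst emeasure_atoms[OF assms]) (auto intro!: suminf_cong simp: ennreal_of_nat_eq_real_of_nat)

lemma emeasure_proc_finite_support:
  assumes "A \<in> sets borel" and "\<And>i. i \<ge> n \<Longrightarrow> real i \<in> A \<Longrightarrow> c i w = 0"
  shows "emeasure (proc w) A = of_nat (\<Sum>j | j < n \<and> real j \<in> A. c j w)"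
proof -
  have "emeasure (proc w) A = (\<Sum>i | i < n \<and> real i \<in> A. of_nat (if real i \<in> A then c i w else 0))"
    unfolding emeasure_proc[OF assms(1)] using assms(2) by (intro suminf_finite) (auto simp: not_less)
  then show ?thesis by simp
qed

lemma emeasure_proc_cases:
  assumes "A \<in> sets borel"
  obtains "emeasure (proc w) A = \<infinity>"
  | n where "\<And>i. i \<ge> n \<Longrightarrow> real i \<in> A \<Longrightarrow> c i w = 0"
  using suminf_of_nat_eq_top_or_finite_support[of "\<lambda>i. if real i \<in> A then c i w else 0"]
  unfolding emeasure_proc[OF assms, symmetric] by (auto split: if_splits)

lemma measurable_emeasure_proc:
  "A \<in> sets borel \<Longrightarrow> (\<lambda>w. emeasure (proc w) A) \<in> borel_measurable M"
  unfolding emeasure_proc by measurable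

text \<open>The number of points in \<open>A\<close> is the limit of the numbers at the first n
  atoms of \<open>A\<close>. These are Poisson by \<open>prob_sum_c\<close>; the probabilities
  converge by dominated convergence and the parameters \<open>L n\<close> converge to the measure of
  \<open>A\<close>, so both limits agree.\<close>

lemma prob_emeasure_proc:
  assumes A: "A \<in> sets borel" and fin: "emeasure (atoms lam) A < \<infinity>"
  shows "prob {w \<in> space M. emeasure (proc w) A = of_nat k} =
    exp (- measure (atoms lam) A) * measure (atoms lam) A ^ k / fact k"
proof -
  define J where "J n = {j. j < n \<and> real j \<in> A}" for n
  define L where "L n = (\<Sum>j\<in>J n. lam j)" for n
  define E where "E = {w \<in> space M. emeasure (proc w) A = of_nat k}"
  define E' where "E' n = {w \<in> space M. (\<Sum>j\<in>J n. c j w) = k}" for n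
  have [measurable]: "E \<in> sets M" "E' n \<in> sets M" for n
    unfolding E_def E'_def using measurable_emeasure_proc[OF A] by measurable
  have [simp]: "finite (J n)" for n by (simp add: J_def)
  have part: "(\<Sum>i<n. if real i \<in> A then f i else 0) = (\<Sum>j\<in>J n. f j)"
    for f :: "nat \<Rightarrow> 'b::comm_monoid_add" and n
    by (rule sum.mono_neutral_cong_right) (auto simp: J_def)

  \<comment> \<open>If \<open>A\<close> has infinitely many points, the partial sums exceed k from
    some n on and both indicators are 0. Otherwise the partial sums are eventually constant and
    equal to the number of points.\<close>
  have "eventually (\<lambda>n. indicator (E' n) w = (indicator E w :: real)) sequentially"
    if w: "w \<in> space M" for w
  proof (cases rule: emeasure_proc_cases[OF A, of w])
    case 1
    have "(\<lambda>n. \<Sum>i<n. of_nat (if real i \<in> A then c i w else 0) :: ennreal) \<longlonglongrightarrow> \<infinity>"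
      using 1 unfolding emeasure_proc[OF A] by (metis summable_LIMSEQ summableI)
    then have "(\<lambda>n. of_nat (\<Sum>j\<in>J n. c j w) :: ennreal) \<longlonglongrightarrow> \<infinity>"
      by (simp only: part of_nat_sum [symmetric])
    then have "eventually (\<lambda>n. of_nat k < (of_nat (\<Sum>j\<in>J n. c j w) :: ennreal)) sequentially"
      by (rule order_tendstoD) (simp add: of_nat_less_top)
    then show ?thesis
      by eventually_elim (use 1 in \<open>auto simp: E_def E'_def indicator_def\<close>)
  next
    case (2 m)
    have "emeasure (proc w) A = of_nat (\<Sum>j\<in>J n. c j w)" if "n \<ge> m" for n
      unfolding J_def by (rule emeasure_proc_finite_support[OF A]) (use 2 that in auto)
    then show ?thesis
      unfolding eventually_sequentially using w
      by (intro exI[of _ m]) (auto simp: E_def E'_def indicator_def simp del: of_nat_sum)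
  qed
  then have "(\<lambda>n. indicator (E' n) w) \<longlonglongrightarrow> (indicator E w :: real)" if "w \<in> space M" for w
    using that by (intro tendsto_eventually) auto
  then have "(\<lambda>n. \<integral>w. indicator (E' n) w \<partial>M) \<longlonglongrightarrow> (\<integral>w. (indicator E w :: real) \<partial>M)"
    by (intro integral_dominated_convergence[where w = "\<lambda>_. 1"]) auto
  then have lim1: "(\<lambda>n. prob (E' n)) \<longlonglongrightarrow> prob E"
    by simp

  have "emeasure (atoms lam) A = (\<Sum>i. ennreal (if real i \<in> A then lam i else 0))"
    unfolding emeasure_atoms[OF A] by (auto intro!: suminf_cong)
  moreover from this have "summable (\<lambda>i. if real i \<in> A then lam i else 0)"
    using fin lam_pos by (intro summable_suminf_not_top) (auto intro: less_imp_le)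
  ultimately have "measure (atoms lam) A = (\<Sum>i. if real i \<in> A then lam i else 0)"
    using lam_pos by (simp add: measure_def suminf_ennreal2 less_imp_le suminf_nonneg)
  with \<open>summable _\<close> have "L \<longlonglongrightarrow> measure (atoms lam) A"
    using summable_LIMSEQ[of "\<lambda>i. if real i \<in> A then lam i else 0"] by (simp add: part L_def [abs_def])
  then have "(\<lambda>n. exp (- L n) * L n ^ k / fact k) \<longlonglongrightarrow>
      exp (- measure (atoms lam) A) * measure (atoms lam) A ^ k / fact k"
    by (intro tendsto_intros) auto
  then have lim2: "(\<lambda>n. prob (E' n)) \<longlonglongrightarrow> exp (- measure (atoms lam) A) * measure (atoms lam) A ^ k / fact k"
    by (simp add: E'_def prob_sum_c L_def)
  from LIMSEQ_unique[OF lim1 lim2] show ?thesis by (simp add: E_def)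
qed

text \<open>Disjoint sets read disjoint blocks \<open>K i\<close> of the independent counts, and
  measurable functions of disjoint blocks are independent.\<close>

lemma indep_emeasure_proc:
  fixes A :: "nat \<Rightarrow> real set"
  assumes A: "\<And>i. i < k \<Longrightarrow> A i \<in> sets borel" and disj: "disjoint_family_on A {..<k}"
  shows "indep_vars (\<lambda>_. borel) (\<lambda>i w. emeasure (proc w) (A i)) {..<k}"
proof -
  define K where "K i = {j. real j \<in> A i}" for i
  \<comment> \<open>The test for membership in \<open>K i\<close> keeps \<open>Y i\<close> from
    reading coordinates outside the block, where a restricted function is
    \<open>undefined\<close>.\<close>
  define Y where "Y i f = (\<Sum>j. of_nat (if j \<in> K i then f j else 0) :: ennreal)"
    for i and f :: "nat \<Rightarrow> nat"
  have "indep_vars (\<lambda>i. PiM (K i) (\<lambda>_. count_space UNIV)) (\<lambda>i w. restrict (\<lambda>j. c j w) (K i)) {..<k}"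
    using disj by (intro indep_vars_restrict[OF indep_c]) (auto simp: disjoint_family_on_def K_def)
  moreover have "Y i \<in> borel_measurable (PiM (K i) (\<lambda>_. count_space UNIV))" for i
  proof -
    have "(\<lambda>f. of_nat (if j \<in> K i then f j else 0) :: ennreal)
        \<in> borel_measurable (PiM (K i) (\<lambda>_. count_space UNIV))" for j
      by (cases "j \<in> K i") (auto intro!: measurable_compose[OF measurable_component_singleton])
    then show ?thesis
      unfolding Y_def by measurable
  qed
  ultimately have "indep_vars (\<lambda>_. borel) (\<lambda>i w. Y i (restrict (\<lambda>j. c j w) (K i))) {..<k}"
    by (rule indep_vars_compose2)
  also have "?this \<longleftrightarrow> ?thesis"
  proof (intro indep_vars_cong refl ext)
    fix i w assume "i \<in> {..<k}"
    then have "emeasure (proc w) (A i) = (\<Sum>j. of_nat (if real j \<in> A i then c j w else 0))"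
      using A by (intro emeasure_proc) auto
    also have "\<dots> = Y i (restrict (\<lambda>j. c j w) (K i))"
      unfolding Y_def by (intro suminf_cong) (auto simp: K_def)
    finally show "Y i (restrict (\<lambda>j. c j w) (K i)) = emeasure (proc w) (A i)" by simp
  qed
  finally show ?thesis .
qed

sublocale poisson_process M "atoms lam" proc
proof -
  interpret mu: sigma_finite_measure "atoms lam" by (rule sigma_finite_atoms)
  show "poisson_process M (atoms lam) proc"
  proof
    fix w A assume A: "A \<in> sets (atoms lam)"
    show "emeasure (proc w) A \<in> insert \<infinity> (range of_nat)"
    proof (cases rule: emeasure_proc_cases[OF A[unfolded sets_atoms], of w])
      case (2 n)
      then have "emeasure (proc w) A = of_nat (\<Sum>j | j < n \<and> real j \<in> A. c j w)"
        using A by (intro emeasure_proc_finite_support) auto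
      then show ?thesis by blast
    qed auto
  qed (use measurable_emeasure_proc prob_emeasure_proc indep_emeasure_proc in \<open>auto simp: proc_def\<close>)
qed

end

section \<open>Realisation of the counts on a product space\<close>

text \<open>The Poisson laws are pushed to the real line so that the sample space consists of real
  sequences; rounding down recovers the counts, since almost every coordinate is a natural
  number.\<close>

lemma indep_poisson_PiM:
  assumes "\<And>i. lam i > 0"
  defines "D \<equiv> \<lambda>i. distr (measure_pmf (poisson_pmf (lam i))) borel real"
  shows "indep_poisson (PiM UNIV D) lam (\<lambda>i w. nat \<lfloor>w i\<rfloor>)"
proof -
  have D: "prob_space (D i)" for i
    unfolding D_def by (intro prob_space.prob_space_distr prob_space_measure_pmf) auto
  interpret M: prob_space "PiM UNIV D" using D by (rule prob_space_PiM)
  have [measurable_cong]: "sets (D i) = sets borel" for i by (simp add: D_def)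
  have coord: "distr (PiM UNIV D) (D i) (\<lambda>w. w i) = D i" for i
    using D by (intro distr_PiM_component) auto
  have "M.indep_vars D (\<lambda>i w. w i) UNIV"
    by (subst M.indep_vars_iff_distr_eq_PiM) (auto simp: coord distr_id2 restrict_UNIV)
  then have "M.indep_vars (\<lambda>_. count_space UNIV) (\<lambda>i w. nat \<lfloor>w i\<rfloor>) UNIV"
    by (rule M.indep_vars_compose2) measurable
  moreover have "distr (PiM UNIV D) (count_space UNIV) (\<lambda>w. nat \<lfloor>w i\<rfloor>) = measure_pmf (poisson_pmf (lam i))" for i
  proof -
    have "distr (PiM UNIV D) (count_space UNIV) (\<lambda>w. nat \<lfloor>w i\<rfloor>) =
        distr (distr (PiM UNIV D) (D i) (\<lambda>w. w i)) (count_space UNIV) (\<lambda>x. nat \<lfloor>x\<rfloor>)"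
      by (subst distr_distr) (auto simp: comp_def)
    also have "\<dots> = distr (measure_pmf (poisson_pmf (lam i))) (count_space UNIV) (\<lambda>k. k)"
      unfolding coord unfolding D_def by (subst distr_distr) (auto simp: comp_def)
    finally show ?thesis by (simp add: distr_id2)
  qed
  ultimately show ?thesis
    using assms by unfold_locales auto
qed

section \<open>Measurability with respect to the process, and L2 limits\<close>

lemma (in poisson_process) borel_measurable_emeasure_sigma_N:
  assumes "A \<in> sets mu"
  shows "(\<lambda>w. emeasure (N w) A) \<in> borel_measurable sigma_N"
proof (rule measurableI)
  fix B :: "ennreal set" assume "B \<in> sets borel"
  moreover have "space sigma_N = space M"
    unfolding sigma_N_def by (rule space_measure_of) auto
  moreover have "sets sigma_N = sigma_sets (space M)
      {(\<lambda>w. emeasure (N w) A) -` B \<inter> space M | A B. A \<in> sets mu \<and> B \<in> sets borel}"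
    unfolding sigma_N_def by (rule sets_measure_of) auto
  ultimately show "(\<lambda>w. emeasure (N w) A) -` B \<inter> space sigma_N \<in> sets sigma_N"
    using assms by (auto intro!: sigma_sets.Basic)
qed auto

text \<open>Constant approximating sequences suffice on \<open>D\<close>. For indicator kernels this
  leaves only the explicit formula to be evaluated.\<close>

lemma (in poisson_process) L2_extension_refl:
  assumes "f \<in> L2 Q" "f \<in> D" "X \<in> L2_N" "AE w in M. X w = I f w"
  shows "L2_extension Q D I f X"
  unfolding L2_extension_def using assms
  by (auto simp: L2_tendsto_def intro!: exI[of _ "\<lambda>_. f"] exI[of _ "\<lambda>_. X"])

text \<open>By orthogonality to \<open>Y k\<close>, the integral of Z H equals that of Z (H - Y k),
  and Young's inequality bounds the latter by t E(Z^2) + E((Y k - H)^2) / t. Letting k tend to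
  infinity and then t to 0 gives the claim.\<close>

lemma (in prob_space) integral_mult_eq_0_if_L2_tendsto:
  assumes Z: "Z \<in> L2 M" and Y: "\<And>k. Y k \<in> L2 M" and H: "H \<in> L2 M"
    and lim: "L2_tendsto M Y H" and orth: "\<And>k. (\<integral>w. Z w * Y k w \<partial>M) = 0"
  shows "(\<integral>w. Z w * H w \<partial>M) = 0"
proof -
  have int_mult: "integrable M (\<lambda>w. X w * X' w)" if "X \<in> L2 M" "X' \<in> L2 M" for X X'
  proof (rule Bochner_Integration.integrable_bound)
    show "integrable M (\<lambda>w. (X w)\<^sup>2 + (X' w)\<^sup>2)"
      using that by (auto simp: L2_def)
    show "(\<lambda>w. X w * X' w) \<in> borel_measurable M"
      using that by (auto simp: L2_def)
    show "AE w in M. norm (X w * X' w) \<le> norm ((X w)\<^sup>2 + (X' w)\<^sup>2)"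
    proof (intro always_eventually allI)
      fix w
      have "2 * (\<bar>X w\<bar> * \<bar>X' w\<bar>) \<le> (X w)\<^sup>2 + (X' w)\<^sup>2"
        using sum_squares_bound[of "\<bar>X w\<bar>" "\<bar>X' w\<bar>"] by simp
      moreover have "0 \<le> \<bar>X w\<bar> * \<bar>X' w\<bar>" by simp
      ultimately have "\<bar>X w\<bar> * \<bar>X' w\<bar> \<le> (X w)\<^sup>2 + (X' w)\<^sup>2"
        by linarith
      then show "norm (X w * X' w) \<le> norm ((X w)\<^sup>2 + (X' w)\<^sup>2)"
        by (simp add: abs_mult)
    qed
  qed
  define d where "d k = (\<integral>w. (Y k w - H w)\<^sup>2 \<partial>M)" for k
  define z where "z = (\<integral>w. (Z w)\<^sup>2 \<partial>M)"
  have int_d: "integrable M (\<lambda>w. (Y k w - H w)\<^sup>2)" for k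
  proof -
    have "integrable M (\<lambda>w. (Y k w)\<^sup>2 + (H w)\<^sup>2 - 2 * (Y k w * H w))"
      using Y[of k] H int_mult[OF Y[of k] H] by (auto simp: L2_def)
    then show ?thesis by (simp add: power2_diff mult.assoc)
  qed
  have bound: "\<bar>\<integral>w. Z w * H w \<partial>M\<bar> \<le> t * z + d k / t" if "t > 0" for t k
  proof -
    have "(\<integral>w. Z w * H w \<partial>M) = (\<integral>w. Z w * H w - Z w * Y k w \<partial>M)"
      using int_mult[OF Z H] int_mult[OF Z Y[of k]] orth[of k] by simp
    also have "\<bar>\<dots>\<bar> \<le> (\<integral>w. \<bar>Z w * H w - Z w * Y k w\<bar> \<partial>M)"
      by (rule integral_abs_bound)
    also have "\<dots> \<le> (\<integral>w. t * (Z w)\<^sup>2 + (Y k w - H w)\<^sup>2 / t \<partial>M)"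
    proof (rule integral_mono)
      fix w
      have "2 * (t * \<bar>Z w\<bar>) * \<bar>Y k w - H w\<bar> \<le> (t * \<bar>Z w\<bar>)\<^sup>2 + (Y k w - H w)\<^sup>2"
        using sum_squares_bound[of "t * \<bar>Z w\<bar>" "\<bar>Y k w - H w\<bar>"] by simp
      moreover have "0 \<le> t * \<bar>Z w\<bar> * \<bar>Y k w - H w\<bar>" using that by simp
      ultimately have "t * (\<bar>Z w\<bar> * \<bar>Y k w - H w\<bar>) \<le> (t * \<bar>Z w\<bar>)\<^sup>2 + (Y k w - H w)\<^sup>2"
        by linarith
      then have "\<bar>Z w\<bar> * \<bar>Y k w - H w\<bar> \<le> t * (Z w)\<^sup>2 + (Y k w - H w)\<^sup>2 / t"
        using that by (simp add: field_simps power2_eq_square)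
      then show "\<bar>Z w * H w - Z w * Y k w\<bar> \<le> t * (Z w)\<^sup>2 + (Y k w - H w)\<^sup>2 / t"
        by (simp add: abs_mult [symmetric] abs_minus_commute right_diff_distrib)
    qed (use int_mult[OF Z H] int_mult[OF Z Y[of k]] int_d[of k] Z in \<open>auto simp: L2_def\<close>)
    also have "\<dots> = t * z + d k / t"
      using int_d[of k] Z by (simp add: L2_def z_def d_def)
    finally show ?thesis .
  qed
  have "d \<longlonglongrightarrow> 0"
    using lim by (simp add: L2_tendsto_def d_def [abs_def])
  have "\<bar>\<integral>w. Z w * H w \<partial>M\<bar> \<le> t * z" if "t > 0" for t
  proof (rule tendsto_lowerbound)
    have "(\<lambda>k. t * z + d k / t) \<longlonglongrightarrow> t * z + 0 / t"
      using that by (intro tendsto_intros \<open>d \<longlonglongrightarrow> 0\<close>) auto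
    then show "(\<lambda>k. t * z + d k / t) \<longlonglongrightarrow> t * z" by simp
  qed (use bound[OF that] in auto)
  then have "\<forall>\<^sub>F t in at_right 0. \<bar>\<integral>w. Z w * H w \<partial>M\<bar> \<le> t * z"
    by (auto simp: eventually_at_filter)
  moreover have "((\<lambda>t. t * z) \<longlongrightarrow> 0 * z) (at_right 0)"
    by (intro tendsto_intros)
  ultimately have "\<bar>\<integral>w. Z w * H w \<partial>M\<bar> \<le> 0 * z"
    by (intro tendsto_lowerbound[OF _ _ trivial_limit_at_right_real]) auto
  then show ?thesis by simp
qed

section \<open>Centred counts and their mixed moments\<close>

context indep_poisson
begin

definition centred :: "nat \<Rightarrow> 'w \<Rightarrow> real" where
  "centred a w = real (c a w) - lam a"

lemma borel_measurable_c [measurable]: "(\<lambda>w. real (c a w)) \<in> borel_measurable M"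
  by measurable

lemma borel_measurable_sigma_N_c: "(\<lambda>w. real (c a w)) \<in> borel_measurable sigma_N"
proof -
  have "(\<lambda>w. enn2real (emeasure (proc w) {real a})) \<in> borel_measurable sigma_N"
    using borel_measurable_emeasure_sigma_N[of "{real a}"] by simp
  then show ?thesis
    by (simp add: proc_def emeasure_atoms_singleton)
qed

lemma borel_measurable_sigma_N_centred: "centred a \<in> borel_measurable sigma_N"
  unfolding centred_def [abs_def]
  by (intro borel_measurable_diff borel_measurable_sigma_N_c borel_measurable_const)

lemma borel_measurable_centred [measurable]: "centred a \<in> borel_measurable M"
  unfolding centred_def [abs_def] by measurable

lemma integrable_c: "integrable M (\<lambda>w. real (c a w))"
  using nn_integral_c[of of_nat a] lam_pos[of a]
  by (intro integrableI_nonneg) (auto simp: nn_integral_poisson_pmf_of_nat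
      ennreal_of_nat_eq_real_of_nat [symmetric])

lemma integral_c: "(\<integral>w. real (c a w) \<partial>M) = lam a"
  using nn_integral_c[of of_nat a] lam_pos[of a]
  by (subst integral_eq_nn_integral) (auto simp: nn_integral_poisson_pmf_of_nat
      ennreal_of_nat_eq_real_of_nat [symmetric])

lemma nn_integral_c_power2: "(\<integral>\<^sup>+w. ennreal ((real (c a w))\<^sup>2) \<partial>M) = ennreal (lam a * (lam a + 1))"
  using nn_integral_c[of "\<lambda>k. (of_nat k)\<^sup>2" a] lam_pos[of a]
  by (simp add: nn_integral_poisson_pmf_of_nat_power2
      ennreal_of_nat_eq_real_of_nat [symmetric] ennreal_power [symmetric])

lemma nn_integral_c_power3:
  "(\<integral>\<^sup>+w. ennreal ((real (c a w)) ^ 3) \<partial>M) = ennreal (lam a * (lam a * (lam a + 1) + 2 * lam a + 1))"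
  using nn_integral_c[of "\<lambda>k. (of_nat k) ^ 3" a] lam_pos[of a]
  by (simp add: nn_integral_poisson_pmf_of_nat_power3
      ennreal_of_nat_eq_real_of_nat [symmetric] ennreal_power [symmetric])

lemma integrable_c_power2: "integrable M (\<lambda>w. (real (c a w))\<^sup>2)"
  by (intro integrableI_nonneg) (auto simp: nn_integral_c_power2)

lemma integrable_centred: "integrable M (centred a)"
  unfolding centred_def [abs_def] using integrable_c by simp

lemma integral_centred: "(\<integral>w. centred a w \<partial>M) = 0"
  unfolding centred_def [abs_def] using integrable_c by (simp add: integral_c prob_space)

text \<open>The bound is linear in the rate, so that integrability of a kernel with respect to the
  intensity controls series of first absolute moments.\<close>

lemma integral_abs_centred_le: "(\<integral>w. \<bar>centred a w\<bar> \<partial>M) \<le> 2 * lam a"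
proof -
  have "(\<integral>w. \<bar>centred a w\<bar> \<partial>M) \<le> (\<integral>w. real (c a w) + lam a \<partial>M)"
    using integrable_c lam_pos[of a] integrable_centred
    by (intro integral_mono) (auto simp: centred_def)
  then show ?thesis
    using integrable_c by (simp add: integral_c prob_space)
qed

lemma integrable_centred_power2: "integrable M (\<lambda>w. (centred a w)\<^sup>2)"
proof -
  have "integrable M (\<lambda>w. (real (c a w))\<^sup>2 + (lam a)\<^sup>2 - 2 * lam a * real (c a w))"
    using integrable_c_power2 integrable_c by auto
  then show ?thesis by (simp add: centred_def power2_diff mult_ac)
qed

lemma
  fixes h h' :: "nat \<Rightarrow> real"
  assumes "a \<noteq> b" "integrable M (\<lambda>w. h (c a w))" "integrable M (\<lambda>w. h' (c b w))"
  shows integrable_c_mult: "integrable M (\<lambda>w. h (c a w) * h' (c b w))"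
    and integral_c_mult: "(\<integral>w. h (c a w) * h' (c b w) \<partial>M) = (\<integral>w. h (c a w) \<partial>M) * (\<integral>w. h' (c b w) \<partial>M)"
proof -
  define f where "f i = (if i = a then h else h')" for i
  have ind: "indep_vars (\<lambda>_. borel) (\<lambda>i w. f i (c i w)) {a, b}"
    by (rule indep_c_compose) auto
  have int: "integrable M (\<lambda>w. f i (c i w))" if "i \<in> {a, b}" for i
    using that assms by (auto simp: f_def)
  show "integrable M (\<lambda>w. h (c a w) * h' (c b w))"
    using indep_vars_integrable[OF _ ind int] assms(1) by (simp add: f_def)
  show "(\<integral>w. h (c a w) * h' (c b w) \<partial>M) = (\<integral>w. h (c a w) \<partial>M) * (\<integral>w. h' (c b w) \<partial>M)"
    using indep_vars_lebesgue_integral[OF _ ind int] assms(1) by (simp add: f_def)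
qed

lemma
  fixes h h' h'' :: "nat \<Rightarrow> real"
  assumes "a \<noteq> b" "i \<noteq> a" "i \<noteq> b" "integrable M (\<lambda>w. h (c a w))" "integrable M (\<lambda>w. h' (c b w))"
    "integrable M (\<lambda>w. h'' (c i w))"
  shows integrable_c_mult3: "integrable M (\<lambda>w. h (c a w) * h' (c b w) * h'' (c i w))"
    and integral_c_mult3: "(\<integral>w. h (c a w) * h' (c b w) * h'' (c i w) \<partial>M) =
      (\<integral>w. h (c a w) \<partial>M) * (\<integral>w. h' (c b w) \<partial>M) * (\<integral>w. h'' (c i w) \<partial>M)"
proof -
  define f where "f j = (if j = a then h else if j = b then h' else h'')" for j
  have ind: "indep_vars (\<lambda>_. borel) (\<lambda>i w. f i (c i w)) {a, b, i}"
    by (rule indep_c_compose) auto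
  have int: "integrable M (\<lambda>w. f j (c j w))" if "j \<in> {a, b, i}" for j
    using that assms by (auto simp: f_def)
  show "integrable M (\<lambda>w. h (c a w) * h' (c b w) * h'' (c i w))"
    using indep_vars_integrable[OF _ ind int] assms(1-3) by (simp add: f_def mult.assoc)
  show "(\<integral>w. h (c a w) * h' (c b w) * h'' (c i w) \<partial>M) =
      (\<integral>w. h (c a w) \<partial>M) * (\<integral>w. h' (c b w) \<partial>M) * (\<integral>w. h'' (c i w) \<partial>M)"
    using indep_vars_lebesgue_integral[OF _ ind int] assms(1-3) by (simp add: f_def mult.assoc)
qed

text \<open>Since \<open>a\<close> and \<open>b\<close> differ, some index occurs exactly once among
  \<open>a\<close>, \<open>b\<close>, \<open>i\<close>; its centred count has mean 0 and is
  independent of the other factors.\<close>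

lemma
  assumes "a \<noteq> b"
  shows integrable_centred_mult3: "integrable M (\<lambda>w. centred a w * centred b w * centred i w)"
    and integral_centred_mult3: "(\<integral>w. centred a w * centred b w * centred i w \<partial>M) = 0"
proof -
  have sq: "integrable M (\<lambda>w. (centred a w)\<^sup>2 * centred b w) \<and> (\<integral>w. (centred a w)\<^sup>2 * centred b w \<partial>M) = 0"
    if "a \<noteq> b" for a b
    using integrable_c_mult[OF that, of "\<lambda>k. (real k - lam a)\<^sup>2" "\<lambda>k. real k - lam b"]
      integral_c_mult[OF that, of "\<lambda>k. (real k - lam a)\<^sup>2" "\<lambda>k. real k - lam b"]
      integrable_centred_power2[of a] integrable_centred[of b] integral_centred[of b]
    by (simp add: centred_def [abs_def])
  have "integrable M (\<lambda>w. centred a w * centred b w * centred i w) \<and> (\<integral>w. centred a w * centred b w * centred i w \<partial>M) = 0"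
  proof -
    consider "i = a" | "i = b" | "i \<noteq> a" "i \<noteq> b" by blast
    then show ?thesis
    proof cases
      case 1
      then show ?thesis using sq[OF assms] by (simp add: power2_eq_square mult_ac)
    next
      case 2
      then show ?thesis using \<open>a \<noteq> b\<close> sq[of b a] by (simp add: power2_eq_square mult_ac)
    next
      case 3
      show ?thesis
        using integrable_c_mult3[OF assms 3, of "\<lambda>k. real k - lam a" "\<lambda>k. real k - lam b" "\<lambda>k. real k - lam i"]
          integral_c_mult3[OF assms 3, of "\<lambda>k. real k - lam a" "\<lambda>k. real k - lam b" "\<lambda>k. real k - lam i"]
          integrable_centred[of a] integrable_centred[of b] integrable_centred[of i] integral_centred[of i]
        by (simp add: centred_def [abs_def])
    qed
  qed
  then show "integrable M (\<lambda>w. centred a w * centred b w * centred i w)"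
    "(\<integral>w. centred a w * centred b w * centred i w \<partial>M) = 0" by auto
qed

lemma L2_N_centred: "centred a \<in> L2_N"
  using integrable_centred_power2 borel_measurable_sigma_N_centred by (auto simp: L2_N_def L2_def)

lemma L2_N_if_factors:
  assumes "a \<noteq> b" and X: "X \<in> borel_measurable sigma_N"
    and h: "integrable M (\<lambda>w. (h (c a w))\<^sup>2)" "integrable M (\<lambda>w. (h' (c b w))\<^sup>2)"
    and X_eq: "\<And>w. X w = h (c a w) * h' (c b w) / t"
  shows "X \<in> L2_N"
proof -
  have "(\<lambda>w. h (c a w)) \<in> borel_measurable M" "(\<lambda>w. h' (c b w)) \<in> borel_measurable M"
    by (rule measurable_compose[OF measurable_c], simp)+
  then have "X \<in> borel_measurable M"
    unfolding X_eq [abs_def] by measurable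
  moreover have "integrable M (\<lambda>w. (X w)\<^sup>2)"
    using integrable_c_mult[OF assms(1) h]
    by (simp add: X_eq power_divide power_mult_distrib)
  ultimately show ?thesis
    using X by (simp add: L2_N_def L2_def)
qed

lemma L2_N_centred_mult:
  assumes "a \<noteq> b"
  shows "(\<lambda>w. centred a w * centred b w / t) \<in> L2_N"
proof (rule L2_N_if_factors[OF assms])
  show "(\<lambda>w. centred a w * centred b w / t) \<in> borel_measurable sigma_N"
    by (intro borel_measurable_divide borel_measurable_times borel_measurable_sigma_N_centred
        borel_measurable_const)
qed (use integrable_centred_power2 in \<open>auto simp: centred_def\<close>)

lemma L2_N_mult_c:
  assumes "a \<noteq> b"
  shows "(\<lambda>w. centred a w * real (c b w) / t) \<in> L2_N"
proof (rule L2_N_if_factors[OF assms])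
  show "(\<lambda>w. centred a w * real (c b w) / t) \<in> borel_measurable sigma_N"
    by (intro borel_measurable_divide borel_measurable_times borel_measurable_sigma_N_centred
        borel_measurable_sigma_N_c borel_measurable_const)
qed (use integrable_centred_power2[of a] integrable_c_power2[of b] in \<open>auto simp: centred_def\<close>)

section \<open>First and second chaos components\<close>

lemma L2_indicator_singleton: "(indicator {real a} :: real \<Rightarrow> real) \<in> L2 (atoms lam)"
proof -
  have "(indicator {real a} x :: real)\<^sup>2 = indicator {real a} x" for x
    by (auto simp: indicator_def)
  then show ?thesis
    using integrable_indicator_atoms by (simp add: L2_def)
qed

lemma centred_in_chaos1: "centred a \<in> chaos1"
  unfolding chaos1_def is_I1_def
  using L2_indicator_singleton[of a] L2_N_centred[of a] integrable_indicator_atoms[of lam a] lam_pos[of a]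
  by (auto intro!: bexI[of _ "indicator {real a}"] L2_extension_refl
      simp: I1_formula_def measure_atoms_singleton proc_def centred_def)

text \<open>The series of c i |g i| has expectation equal to the series of lam i |g i|, which is
  finite. So almost surely the integral against the realisation is an absolutely convergent series
  rather than the default value 0, and the two series may be subtracted term by term.\<close>

lemma AE_I1_formula:
  assumes g: "g \<in> borel_measurable borel" and int: "integrable (atoms lam) g"
  shows "AE w in M. summable (\<lambda>i. \<bar>g (real i) * centred i w\<bar>) \<and>
    I1_formula g w = (\<Sum>i. g (real i) * centred i w)"
proof -
  have sl: "summable (\<lambda>i. lam i * \<bar>g (real i)\<bar>)"
    using int integrable_atoms_iff[OF g, of lam] by simp
  have "(\<integral>\<^sup>+w. (\<Sum>i. ennreal (real (c i w) * \<bar>g (real i)\<bar>)) \<partial>M) =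
      (\<Sum>i. \<integral>\<^sup>+w. ennreal (real (c i w) * \<bar>g (real i)\<bar>) \<partial>M)"
    by (rule nn_integral_suminf) measurable
  also have "\<dots> = (\<Sum>i. ennreal (lam i * \<bar>g (real i)\<bar>))"
    using integrable_c integral_c by (intro suminf_cong, subst nn_integral_eq_integral) auto
  also have "\<dots> \<noteq> \<infinity>"
    using sl by (subst suminf_ennreal2) auto
  finally have "AE w in M. (\<Sum>i. ennreal (real (c i w) * \<bar>g (real i)\<bar>)) \<noteq> \<infinity>"
    by (intro nn_integral_PInf_AE) auto
  then show ?thesis
  proof eventually_elim
    case (elim w)
    then have sc: "summable (\<lambda>i. real (c i w) * \<bar>g (real i)\<bar>)"
      by (intro summable_suminf_not_top) auto
    have "summable (\<lambda>i. \<bar>g (real i) * centred i w\<bar>)"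
    proof (rule summable_comparison_test')
      show "summable (\<lambda>i. real (c i w) * \<bar>g (real i)\<bar> + lam i * \<bar>g (real i)\<bar>)"
        using sc sl by (rule summable_add)
      fix i :: nat
      have "\<bar>centred i w\<bar> \<le> real (c i w) + lam i"
        using lam_pos[of i] by (auto simp: centred_def)
      then have "\<bar>centred i w\<bar> * \<bar>g (real i)\<bar> \<le> (real (c i w) + lam i) * \<bar>g (real i)\<bar>"
        by (intro mult_right_mono) auto
      then show "norm \<bar>g (real i) * centred i w\<bar> \<le> real (c i w) * \<bar>g (real i)\<bar> + lam i * \<bar>g (real i)\<bar>"
        by (simp add: abs_mult algebra_simps)
    qed
    moreover have "summable (\<lambda>i. real (c i w) * g (real i))" "summable (\<lambda>i. lam i * g (real i))"
      using sc sl by - (rule summable_rabs_cancel, simp add: abs_mult)+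
    then have "(\<Sum>i. real (c i w) * g (real i)) - (\<Sum>i. lam i * g (real i)) = (\<Sum>i. g (real i) * centred i w)"
      by (subst suminf_diff) (auto simp: centred_def algebra_simps)
    ultimately show ?case
      unfolding I1_formula_def proc_def
      using integral_atoms[OF g _ sc] integral_atoms[OF g _ sl] by simp
  qed
qed

text \<open>Expanding the integral into the series over the atoms and integrating term by term
  leaves mixed third moments, all of which vanish by \<open>integral_centred_mult3\<close>.\<close>

lemma integral_centred_mult_I1_formula:
  assumes "a \<noteq> b" and g: "g \<in> borel_measurable borel" and int: "integrable (atoms lam) g"
    and Y: "Y \<in> borel_measurable M" "AE w in M. Y w = I1_formula g w"
  shows "(\<integral>w. centred a w * centred b w / t * Y w \<partial>M) = 0"
proof -
  define f where "f i w = g (real i) / t * (centred a w * centred b w * centred i w)" for i w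
  have sl: "summable (\<lambda>i. lam i * \<bar>g (real i)\<bar>)"
    using int integrable_atoms_iff[OF g, of lam] by simp
  have int_f: "integrable M (f i)" for i
    unfolding f_def using integrable_centred_mult3[OF assms(1)] by auto
  have [measurable]: "f i \<in> borel_measurable M" for i
    using int_f by auto
  have AE: "AE w in M. summable (\<lambda>i. norm (f i w)) \<and> centred a w * centred b w / t * Y w = (\<Sum>i. f i w)"
    using AE_I1_formula[OF g int] Y(2)
  proof eventually_elim
    case (elim w)
    define C where "C = centred a w * centred b w / t"
    have f: "f i w = C * (g (real i) * centred i w)" for i
      by (simp add: f_def C_def)
    have "summable (\<lambda>i. g (real i) * centred i w)"
      by (rule summable_rabs_cancel) (use elim in auto)
    then show ?case
      using elim unfolding f C_def [symmetric]
      by (auto simp: abs_mult suminf_mult intro!: summable_mult)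
  qed
  have "(\<integral>w. centred a w * centred b w / t * Y w \<partial>M) = (\<integral>w. (\<Sum>i. f i w) \<partial>M)"
    using AE Y(1) by (intro integral_cong_AE) auto
  also have "\<dots> = (\<Sum>i. \<integral>w. f i w \<partial>M)"
  proof (rule integral_suminf[OF int_f])
    show "AE w in M. summable (\<lambda>i. norm (f i w))" using AE by auto
    define K where "K = (\<integral>w. \<bar>centred a w\<bar> \<partial>M) * (\<integral>w. \<bar>centred b w\<bar> \<partial>M) / \<bar>t\<bar>"
    show "summable (\<lambda>i. \<integral>w. norm (f i w) \<partial>M)"
    proof (rule summable_comparison_test')
      show "summable (\<lambda>i. 2 * K * (lam i * \<bar>g (real i)\<bar>))"
        using sl by (rule summable_mult)
      \<comment> \<open>Beyond both \<open>a\<close> and \<open>b\<close> the three factors are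
        independent and the absolute moment factorises; the finitely many earlier terms do not
        affect summability.\<close>
      fix i assume i: "i \<ge> Suc (max a b)"
      have "(\<integral>w. \<bar>centred a w\<bar> * \<bar>centred b w\<bar> * \<bar>centred i w\<bar> \<partial>M) =
          (\<integral>w. \<bar>centred a w\<bar> \<partial>M) * (\<integral>w. \<bar>centred b w\<bar> \<partial>M) * (\<integral>w. \<bar>centred i w\<bar> \<partial>M)"
        using integral_c_mult3[OF assms(1), of i "\<lambda>k. \<bar>real k - lam a\<bar>" "\<lambda>k. \<bar>real k - lam b\<bar>" "\<lambda>k. \<bar>real k - lam i\<bar>"]
          i integrable_centred[of a] integrable_centred[of b] integrable_centred[of i]
        by (simp add: centred_def [abs_def])
      then have "(\<integral>w. norm (f i w) \<partial>M) = \<bar>g (real i)\<bar> * K * (\<integral>w. \<bar>centred i w\<bar> \<partial>M)"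
        by (simp add: f_def abs_mult K_def)
      also have "\<dots> \<le> \<bar>g (real i)\<bar> * K * (2 * lam i)"
        by (intro mult_left_mono integral_abs_centred_le) (auto simp: K_def)
      finally show "norm (\<integral>w. norm (f i w) \<partial>M) \<le> 2 * K * (lam i * \<bar>g (real i)\<bar>)"
        by (simp add: mult_ac)
    qed
  qed
  also have "\<dots> = 0"
    by (simp add: f_def integral_centred_mult3[OF assms(1)])
  finally show ?thesis .
qed

text \<open>Members of the first chaos are L2 limits of integrals of integrable kernels, so the
  orthogonality just shown passes to them.\<close>

lemma integral_centred_mult_chaos1:
  assumes "a \<noteq> b" "H \<in> chaos1"
  shows "(\<integral>w. centred a w * centred b w / t * H w \<partial>M) = 0"
proof -
  from assms(2) obtain g Y where H: "H \<in> L2_N" and g: "\<And>k. g k \<in> L2 (atoms lam)" "\<And>k. integrable (atoms lam) (g k)"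
    and Y: "\<And>k. Y k \<in> L2_N" "\<And>k. AE w in M. Y k w = I1_formula (g k) w" "L2_tendsto M Y H"
    unfolding chaos1_def is_I1_def L2_extension_def by blast
  have gm: "g k \<in> borel_measurable borel" for k
    using g(1)[of k] by (simp add: L2_def cong: measurable_cong_sets)
  show ?thesis
  proof (rule integral_mult_eq_0_if_L2_tendsto[OF _ _ _ Y(3)])
    show "(\<lambda>w. centred a w * centred b w / t) \<in> L2 M" "H \<in> L2 M" "Y k \<in> L2 M" for k
      using L2_N_centred_mult[OF assms(1), of t] H Y(1)[of k] by (auto simp: L2_N_def)
    show "(\<integral>w. centred a w * centred b w / t * Y k w \<partial>M) = 0" for k
      using Y(1)[of k] by (intro integral_centred_mult_I1_formula[OF assms(1) gm g(2) _ Y(2)])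
        (auto simp: L2_N_def L2_def)
  qed
qed

lemma is_J1_mult_c:
  assumes "a \<noteq> b"
  shows "is_J1 (\<lambda>w. centred a w * real (c b w) / lam b) (centred a)"
proof -
  \<comment> \<open>What remains after subtracting the candidate projection is a product of two
    centred counts, which is orthogonal to the first chaos.\<close>
  have *: "centred a w * real (c b w) / lam b - centred a w = centred a w * centred b w / lam b" for w
    using lam_pos[of b] by (simp add: centred_def field_simps)
  show ?thesis
    unfolding is_J1_def is_orth_proj_def *
    using L2_N_mult_c[OF assms] centred_in_chaos1 integral_centred_mult_chaos1[OF assms] by auto
qed

lemma centred_mult_in_chaos2:
  assumes "a \<noteq> b"
  shows "(\<lambda>w. centred a w * centred b w / t) \<in> chaos2"
proof -
  interpret P: pair_sigma_finite "atoms lam" "atoms lam"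
    by (intro pair_sigma_finite.intro sigma_finite_atoms)
  \<comment> \<open>The kernel must be symmetric, and each of its two rectangles contributes the
    same product; the factor 2 in the denominator compensates for this.\<close>
  define f :: "real \<times> real \<Rightarrow> real" where
    "f z = (indicator ({real a} \<times> {real b}) z + indicator ({real b} \<times> {real a}) z) / (2 * t)" for z
  have f: "f (x, y) = (indicator {real a} x * indicator {real b} y + indicator {real b} x * indicator {real a} y) / (2 * t)"
    for x y unfolding f_def indicator_times by simp
  \<comment> \<open>The two rectangles are disjoint, so the kernel only takes the values 0 and 1 /
    (2 t).\<close>
  have sq: "(f z)\<^sup>2 = f z / (2 * t)" for z
    using assms by (cases z) (auto simp: f indicator_def power2_eq_square)
  have m: "emeasure (atoms lam \<Otimes>\<^sub>M atoms lam) {(real i, real j)} = ennreal (lam i * lam j)" for i j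
    using sigma_finite_measure.emeasure_pair_measure_Times[OF sigma_finite_atoms,
        of "{real i}" "atoms lam" "{real j}" lam]
    by (simp add: emeasure_atoms_singleton ennreal_mult)
  have int_ind: "integrable (atoms lam \<Otimes>\<^sub>M atoms lam) (indicator ({real i} \<times> {real j}) :: _ \<Rightarrow> real)" for i j
    by (intro integrable_real_indicator pair_measureI) (auto simp: m)
  have int_f: "integrable (atoms lam \<Otimes>\<^sub>M atoms lam) f"
    unfolding f_def using int_ind by auto
  then have L2: "f \<in> L2 (atoms lam \<Otimes>\<^sub>M atoms lam)"
    by (auto simp: L2_def sq)
  have sym: "sym_fun f"
    by (auto simp: sym_fun_def f indicator_def)
  have int1: "(\<integral>x. f (x, y) \<partial>atoms v) = (v a * indicator {real b} y + v b * indicator {real a} y) / (2 * t)"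
    if "\<And>i. v i \<ge> 0" for v y
    using that unfolding f by (simp add: integrable_indicator_atoms measure_atoms_singleton)
  have int2: "(\<integral>y. (\<integral>x. f (x, y) \<partial>atoms v) \<partial>atoms u) = (v a * u b + v b * u a) / (2 * t)"
    if "\<And>i. v i \<ge> 0" "\<And>i. u i \<ge> 0" for v u
    using that unfolding int1[OF that(1)] by (simp add: integrable_indicator_atoms measure_atoms_singleton)
  \<comment> \<open>Distinct atoms make the kernel vanish on the diagonal, which removes the
    diagonal correction from \<open>I2_formula\<close>.\<close>
  have diag: "f (y, y) = 0" for y
    using assms by (auto simp: f indicator_def)
  have int3: "(\<integral>z. f z \<partial>(atoms lam \<Otimes>\<^sub>M atoms lam)) = (lam a * lam b + lam b * lam a) / (2 * t)"
    unfolding f_def using int_ind lam_pos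
    by (simp add: measure_def m space_pair_measure)
  \<comment> \<open>For t = 0 both sides are 0 because division by zero yields 0; hence the case
    distinction.\<close>
  have "I2_formula f w = centred a w * centred b w / t" for w
    unfolding I2_formula_def diag int3 using lam_pos
    by (simp add: proc_def int2 less_imp_le centred_def)
       (cases "t = 0"; simp add: field_simps)
  then show ?thesis
    unfolding chaos2_def is_I2_def using L2 int_f sym L2_N_centred_mult[OF assms]
    by (auto intro!: bexI[of _ f] L2_extension_refl)
qed

lemma mult_c_in_T2:
  assumes "a \<noteq> b"
  shows "(\<lambda>w. centred a w * real (c b w) / lam b) \<in> T2"
proof -
  have "(\<lambda>_. 0) \<in> chaos0"
    by (auto simp: chaos0_def L2_N_def L2_def)
  moreover have "centred a w * real (c b w) / lam b = 0 + centred a w + centred a w * centred b w / lam b" for w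
    using lam_pos[of b] by (simp add: centred_def field_simps)
  ultimately show ?thesis
    unfolding T2_def mem_Collect_eq
    by (intro conjI L2_N_mult_c[OF assms] bexI[OF _ \<open>(\<lambda>_. 0) \<in> chaos0\<close>]
        bexI[OF _ centred_in_chaos1[of a]] bexI[OF _ centred_mult_in_chaos2[OF assms, of "lam b"]] always_eventually) auto
qed

section \<open>Almost sure non-convergence of the first chaos component\<close>

text \<open>A direct second Borel-Cantelli argument. Injectivity keeps the atoms distinct, so the
  counts over a stretch sum to a Poisson variable, which is 0 with probability exp of minus the sum
  of the rates. Were \<open>E\<close> of positive probability, its logarithm would bound the partial
  sums of a divergent series.\<close>

lemma AE_ex_c_pos:
  assumes "inj e" and "\<not> summable (\<lambda>n. lam (e n))"
  shows "AE w in M. \<exists>n\<ge>m. c (e n) w \<noteq> 0"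
proof -
  define E where "E = {w \<in> space M. \<forall>n\<ge>m. c (e n) w = 0}"
  have [measurable]: "E \<in> sets M"
    unfolding E_def by measurable
  have bound: "prob E \<le> exp (- (\<Sum>n\<in>{m..k}. lam (e n)))" for k
  proof -
    have "prob E \<le> prob {w \<in> space M. (\<Sum>j\<in>e ` {m..k}. c j w) = 0}"
      by (intro finite_measure_mono) (auto simp: E_def)
    also have "\<dots> = exp (- (\<Sum>j\<in>e ` {m..k}. lam j))"
      by (subst prob_sum_c) auto
    also have "(\<Sum>j\<in>e ` {m..k}. lam j) = (\<Sum>n\<in>{m..k}. lam (e n))"
      using assms(1) by (subst sum.reindex) (auto intro: inj_on_subset simp: comp_def)
    finally show ?thesis .
  qed
  have "prob E = 0"
  proof (rule ccontr)
    assume "prob E \<noteq> 0"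
    then have pos: "prob E > 0" by (simp add: zero_less_measure_iff)
    have "(\<Sum>n\<le>k. lam (e n)) \<le> (\<Sum>n<m. lam (e n)) - ln (prob E)" for k
    proof -
      have "ln (prob E) \<le> - (\<Sum>n\<in>{m..k}. lam (e n))"
        using bound[of k] pos by (metis ln_exp ln_le_cancel_iff exp_gt_zero)
      moreover have "(\<Sum>n\<le>k. lam (e n)) \<le> (\<Sum>n\<in>{..<m} \<union> {m..k}. lam (e n))"
        by (intro sum_mono2) auto
      moreover have "(\<Sum>n\<in>{..<m} \<union> {m..k}. lam (e n)) = (\<Sum>n<m. lam (e n)) + (\<Sum>n\<in>{m..k}. lam (e n))"
        by (intro sum.union_disjoint) auto
      ultimately show ?thesis by linarith
    qed
    then have "summable (\<lambda>n. lam (e n))"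
      by (intro bounded_imp_summable) auto
    with assms(2) show False ..
  qed
  then have "AE w in M. w \<notin> E"
    by (intro AE_not_in) (auto simp: null_sets_def emeasure_eq_measure)
  then show ?thesis
    using AE_space by eventually_elim (auto simp: E_def)
qed

text \<open>As the rates tend to 0, convergence of the centred counts would make the counts
  themselves tend to 0; being integers, they would eventually vanish, contradicting
  \<open>AE_ex_c_pos\<close>.\<close>

lemma not_AE_centred_tendsto_0:
  assumes "inj e" and "\<not> summable (\<lambda>n. lam (e n))" and "(\<lambda>n. lam (e n)) \<longlonglongrightarrow> 0"
  shows "\<not> (AE w in M. (\<lambda>n. centred (e n) w) \<longlonglongrightarrow> 0)"
proof
  assume "AE w in M. (\<lambda>n. centred (e n) w) \<longlonglongrightarrow> 0"
  moreover have "AE w in M. \<forall>m. \<exists>n\<ge>m. c (e n) w \<noteq> 0"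
    using AE_ex_c_pos[OF assms(1,2)] by (simp add: AE_all_countable)
  ultimately have "AE w in M. False"
  proof eventually_elim
    case (elim w)
    have "(\<lambda>n. centred (e n) w + lam (e n)) \<longlonglongrightarrow> 0 + 0"
      using elim assms(3) by (intro tendsto_add) auto
    then have "(\<lambda>n. real (c (e n) w)) \<longlonglongrightarrow> 0"
      by (simp add: centred_def)
    then have "\<forall>\<^sub>F n in sequentially. real (c (e n) w) < 1"
      by (rule order_tendstoD) simp
    then obtain m where "\<And>n. n \<ge> m \<Longrightarrow> real (c (e n) w) < 1"
      unfolding eventually_sequentially by blast
    with elim show False by force
  qed
  then show False by (simp add: AE_False)
qed

section \<open>Moments of order 5/2\<close>

lemma integrable_c_power3: "integrable M (\<lambda>w. (real (c a w)) ^ 3)"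
  by (intro integrableI_nonneg) (auto simp: nn_integral_c_power3)

lemma integral_c_power2: "(\<integral>w. (real (c a w))\<^sup>2 \<partial>M) = lam a * (lam a + 1)"
  by (subst integral_eq_nn_integral) (auto simp: nn_integral_c_power2)

lemma integral_c_power3_le:
  assumes "lam a \<le> 1"
  shows "(\<integral>w. (real (c a w)) ^ 3 \<partial>M) \<le> 5 * lam a"
proof -
  have "(\<integral>w. (real (c a w)) ^ 3 \<partial>M) = lam a * (lam a * (lam a + 1) + 2 * lam a + 1)"
    by (subst integral_eq_nn_integral) (auto simp: nn_integral_c_power3)
  \<comment> \<open>For rates at most 1, the three summands of the second factor are at most 2, 2
    and 1.\<close>
  also have "\<dots> \<le> lam a * 5"
  proof (intro mult_left_mono)
    have "lam a * (lam a + 1) \<le> 1 * 2"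
      using assms by (intro mult_mono) auto
    then show "lam a * (lam a + 1) + 2 * lam a + 1 \<le> 5" using assms by linarith
  qed auto
  finally show ?thesis by simp
qed

text \<open>The exponent is raised from 5/2 to 3, where exact moments are available; this costs
  nothing in the order of the rate, because all moments of a Poisson count with small rate are of
  the order of that rate. The constant 30 is (5 + 1) 5, and the exponent -3/2 is 1 - 5/2.\<close>

lemma
  assumes "a \<noteq> b" "lam a \<le> 1" "lam b \<le> 1"
  defines "F \<equiv> \<lambda>w. centred a w * real (c b w) / lam b"
  shows integrable_powr_mult_c: "integrable M (\<lambda>w. \<bar>F w\<bar> powr (5/2))"
    and integral_powr_mult_c_le: "(\<integral>w. \<bar>F w\<bar> powr (5/2) \<partial>M) \<le> 30 * lam a * lam b powr (- 3/2)"
proof -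
  define D where "D w = ((real (c a w)) ^ 3 + lam a) * (real (c b w)) ^ 3 / lam b powr (5/2)" for w
  have nat_powr: "real k powr (5/2) \<le> real k ^ 3" for k
  proof (cases "k = 0")
    case False
    then have "real k powr (5/2) \<le> real k powr 3" by (intro powr_mono) auto
    then show ?thesis using False by (simp add: powr_numeral)
  qed simp
  \<comment> \<open>An empty atom leaves \<open>lam a\<close>, whose power 5/2 is at most
    \<open>lam a\<close> as the rate is at most 1. At an occupied atom the count is at least 1,
    hence at least the rate, and dominates the centred count.\<close>
  have le_a: "\<bar>centred a w\<bar> powr (5/2) \<le> (real (c a w)) ^ 3 + lam a" for w
  proof (cases "c a w = 0")
    case True
    have "lam a powr (5/2) \<le> lam a powr 1"
      using assms(2) lam_pos[of a] by (intro powr_mono') auto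
    then show ?thesis using True lam_pos[of a] by (simp add: centred_def)
  next
    case False
    then have "\<bar>centred a w\<bar> \<le> real (c a w)"
      using assms(2) lam_pos[of a] by (auto simp: centred_def)
    then have "\<bar>centred a w\<bar> powr (5/2) \<le> real (c a w) powr (5/2)"
      by (intro powr_mono2) auto
    also have "\<dots> \<le> (real (c a w)) ^ 3" by (rule nat_powr)
    finally show ?thesis using lam_pos[of a] by simp
  qed
  have le: "\<bar>F w\<bar> powr (5/2) \<le> D w" for w
  proof -
    have "\<bar>F w\<bar> powr (5/2) = \<bar>centred a w\<bar> powr (5/2) * real (c b w) powr (5/2) / lam b powr (5/2)"
      by (simp add: F_def abs_mult powr_mult powr_divide)
    also have "\<dots> \<le> D w"
      unfolding D_def by (intro divide_right_mono mult_mono le_a nat_powr) auto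
    finally show ?thesis .
  qed
  have int_a: "integrable M (\<lambda>w. (real (c a w)) ^ 3 + lam a)"
    using integrable_c_power3 by simp
  have int_D: "integrable M D"
    unfolding D_def using integrable_c_mult[OF assms(1) int_a integrable_c_power3] by simp
  have [measurable]: "F \<in> borel_measurable M"
    unfolding F_def by measurable
  show int_F: "integrable M (\<lambda>w. \<bar>F w\<bar> powr (5/2))"
    by (rule Bochner_Integration.integrable_bound[OF int_D])
       (use le in \<open>auto intro!: AE_I2 order_trans[OF _ abs_ge_self]\<close>)
  have "(\<integral>w. \<bar>F w\<bar> powr (5/2) \<partial>M) \<le> (\<integral>w. D w \<partial>M)"
    by (intro integral_mono int_F int_D le)
  also have "\<dots> = ((\<integral>w. (real (c a w)) ^ 3 \<partial>M) + lam a) * (\<integral>w. (real (c b w)) ^ 3 \<partial>M) / lam b powr (5/2)"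
    unfolding D_def using integral_c_mult[OF assms(1) int_a integrable_c_power3] integrable_c_power3
    by (simp add: prob_space)
  also have "\<dots> \<le> (5 * lam a + lam a) * (5 * lam b) / lam b powr (5/2)"
    using integral_c_power3_le assms(2,3) by (intro divide_right_mono mult_mono add_mono) auto
  also have "\<dots> = 30 * lam a * (lam b powr 1 / lam b powr (5/2))"
    using lam_pos[of b] by simp
  also have "lam b powr 1 / lam b powr (5/2) = lam b powr (- 3/2)"
    unfolding powr_diff [symmetric] by simp
  finally show "(\<integral>w. \<bar>F w\<bar> powr (5/2) \<partial>M) \<le> 30 * lam a * lam b powr (- 3/2)" .
qed

section \<open>Summable majorants: almost sure convergence and the supremum\<close>

text \<open>With \<open>P = N(A) N(B) / \<beta>\<close> and \<open>Q = \<epsilon> N(B) / \<beta>\<close> one has \<open>|F| \<le> P + Q\<close>. The majorant dominates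
  \<open>sqrt P + Q\<^sup>2\<close>, because \<open>sqrt k \<le> k\<close> for natural \<open>k\<close>. Its expectations are summable over \<open>n\<close>, which
  gives both the almost sure convergence and the bound on the supremum.\<close>

definition majorant :: "nat \<Rightarrow> nat \<Rightarrow> 'w \<Rightarrow> real" where
  "majorant a b w = real (c a w) * real (c b w) / sqrt (lam b) + (lam a * real (c b w) / lam b)\<^sup>2"

lemma majorant_nonneg [simp]: "0 \<le> majorant a b w"
  by (simp add: majorant_def)

lemma borel_measurable_majorant [measurable]: "majorant a b \<in> borel_measurable M"
  unfolding majorant_def by measurable

lemma nn_integral_majorant:
  assumes "a \<noteq> b"
  shows "(\<integral>\<^sup>+w. ennreal (majorant a b w) \<partial>M) =
    ennreal (lam a * sqrt (lam b) + (lam a)\<^sup>2 * (lam b + 1) / lam b)"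
proof -
  have int: "integrable M (\<lambda>w. real (c a w) * real (c b w))"
    by (rule integrable_c_mult[OF assms integrable_c integrable_c])
  have "(\<integral>\<^sup>+w. ennreal (majorant a b w) \<partial>M) = ennreal (\<integral>w. majorant a b w \<partial>M)"
    using int integrable_c_power2[of b]
    by (intro nn_integral_eq_integral) (auto simp: majorant_def [abs_def] power_divide power_mult_distrib)
  also have "(\<integral>w. majorant a b w \<partial>M) = lam a * lam b / sqrt (lam b) + (lam a)\<^sup>2 * (lam b * (lam b + 1)) / (lam b)\<^sup>2"
    using int integrable_c_power2[of b] integral_c_mult[OF assms integrable_c integrable_c]
    by (simp add: majorant_def [abs_def] power_divide power_mult_distrib integral_c integral_c_power2)
  also have "lam a * lam b / sqrt (lam b) = lam a * sqrt (lam b)"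
    using real_div_sqrt[OF lam_nonneg, of b] by (metis times_divide_eq_right)
  also have "(lam a)\<^sup>2 * (lam b * (lam b + 1)) / (lam b)\<^sup>2 = (lam a)\<^sup>2 * (lam b + 1) / lam b"
    using lam_pos[of b] by (simp add: power2_eq_square)
  finally show ?thesis .
qed

lemma abs_mult_c_le:
  "\<bar>centred a w * real (c b w) / lam b\<bar> \<le> real (c a w) * real (c b w) / lam b + lam a * real (c b w) / lam b"
proof -
  have "\<bar>centred a w\<bar> \<le> real (c a w) + lam a"
    using lam_pos[of a] by (auto simp: centred_def)
  then have "\<bar>centred a w\<bar> * real (c b w) / lam b \<le> (real (c a w) + lam a) * real (c b w) / lam b"
    by (intro divide_right_mono mult_right_mono) auto
  then show ?thesis
    by (simp add: abs_mult distrib_right add_divide_distrib)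
qed

lemma sqrt_mult_c_le:
  "sqrt (real (c a w) * real (c b w) / lam b) \<le> real (c a w) * real (c b w) / sqrt (lam b)"
proof -
  have "sqrt (real k) \<le> real k" for k
    by (cases "k = 0") (auto intro!: real_le_lsqrt simp: power2_eq_square)
  from this[of "c a w * c b w"] show ?thesis
    unfolding real_sqrt_divide by (intro divide_right_mono) auto
qed

text \<open>The square root is subadditive, and sqrt Q is at most 1 if Q is at most 1, and at most
  Q^2 otherwise. This controls the supremum for the exponent 1/2.\<close>

lemma sqrt_abs_mult_c_le:
  "sqrt \<bar>centred a w * real (c b w) / lam b\<bar> \<le> 1 + majorant a b w"
proof -
  define P where "P = real (c a w) * real (c b w) / lam b"
  define Q where "Q = lam a * real (c b w) / lam b"
  have nonneg: "0 \<le> P" "0 \<le> Q" by (auto simp: P_def Q_def)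
  have "sqrt \<bar>centred a w * real (c b w) / lam b\<bar> \<le> sqrt (P + Q)"
    using abs_mult_c_le by (simp add: P_def Q_def)
  also have "\<dots> \<le> sqrt P + sqrt Q"
    using nonneg by (rule sqrt_add_le_add_sqrt)
  also have "sqrt Q \<le> 1 + Q\<^sup>2"
  proof (cases "Q \<le> 1")
    case True
    then have "sqrt Q \<le> 1" by simp
    then show ?thesis by (rule order_trans) simp
  next
    case False
    then have "Q \<le> Q ^ 4" by (intro self_le_power) auto
    then have "sqrt Q \<le> Q\<^sup>2"
      by (intro real_le_lsqrt) (simp_all flip: power_mult)
    then show ?thesis by simp
  qed
  finally show ?thesis
    using sqrt_mult_c_le[of a w b] by (simp add: P_def Q_def majorant_def)
qed

text \<open>Both sqrt P and Q^2 are at most the majorant, so P is at most its square and Q at most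
  its square root. The bound tends to 0 along with the majorant, as needed for almost sure
  convergence.\<close>

lemma abs_mult_c_le_majorant:
  "\<bar>centred a w * real (c b w) / lam b\<bar> \<le> (majorant a b w)\<^sup>2 + sqrt (majorant a b w)"
proof -
  have "real (c a w) * real (c b w) / lam b = (sqrt (real (c a w) * real (c b w) / lam b))\<^sup>2"
    by (subst real_sqrt_pow2) auto
  also have "\<dots> \<le> (majorant a b w)\<^sup>2"
  proof (intro power_mono)
    show "sqrt (real (c a w) * real (c b w) / lam b) \<le> majorant a b w"
      unfolding majorant_def by (rule order_trans[OF sqrt_mult_c_le]) simp
  qed simp
  finally have "real (c a w) * real (c b w) / lam b \<le> (majorant a b w)\<^sup>2" .
  moreover have "lam a * real (c b w) / lam b \<le> sqrt (majorant a b w)"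
    by (intro real_le_rsqrt) (auto simp: majorant_def)
  ultimately show ?thesis
    using abs_mult_c_le[of a w b] by linarith
qed

text \<open>The two summability assumptions concern exactly the two summands of the expected
  majorant in \<open>nn_integral_majorant\<close>.\<close>

context
  fixes a b :: "nat \<Rightarrow> nat"
  assumes ne: "\<And>n. a n \<noteq> b n"
    and sm1: "summable (\<lambda>n. lam (a n) * sqrt (lam (b n)))"
    and sm2: "summable (\<lambda>n. (lam (a n))\<^sup>2 * (lam (b n) + 1) / lam (b n))"
begin

lemma nn_integral_suminf_majorant: "(\<integral>\<^sup>+w. (\<Sum>n. ennreal (majorant (a n) (b n) w)) \<partial>M) < \<infinity>"
proof -
  have "(\<integral>\<^sup>+w. (\<Sum>n. ennreal (majorant (a n) (b n) w)) \<partial>M) =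
      (\<Sum>n. ennreal (lam (a n) * sqrt (lam (b n)) + (lam (a n))\<^sup>2 * (lam (b n) + 1) / lam (b n)))"
    by (subst nn_integral_suminf) (auto simp: nn_integral_majorant[OF ne])
  also have "\<dots> < \<infinity>"
    using summable_add[OF sm1 sm2] by (subst suminf_ennreal2) auto
  finally show ?thesis .
qed

lemma AE_mult_c_tendsto_0:
  "AE w in M. (\<lambda>n. centred (a n) w * real (c (b n) w) / lam (b n)) \<longlonglongrightarrow> 0"
proof -
  have "AE w in M. (\<Sum>n. ennreal (majorant (a n) (b n) w)) \<noteq> \<infinity>"
    using nn_integral_suminf_majorant by (intro nn_integral_PInf_AE) auto
  then show ?thesis
  proof eventually_elim
    case (elim w)
    then have "summable (\<lambda>n. majorant (a n) (b n) w)"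
      by (intro summable_suminf_not_top) auto
    then have "(\<lambda>n. majorant (a n) (b n) w) \<longlonglongrightarrow> 0"
      by (rule summable_LIMSEQ_zero)
    then have "(\<lambda>n. (majorant (a n) (b n) w)\<^sup>2 + sqrt (majorant (a n) (b n) w)) \<longlonglongrightarrow> 0\<^sup>2 + sqrt 0"
      by (intro tendsto_intros)
    then have lim: "(\<lambda>n. (majorant (a n) (b n) w)\<^sup>2 + sqrt (majorant (a n) (b n) w)) \<longlonglongrightarrow> 0"
      by simp
    show ?case
      by (rule Lim_null_comparison[OF always_eventually lim]) (use abs_mult_c_le_majorant in auto)
  qed
qed

text \<open>Each term is at most 1 plus its own majorant, hence at most 1 plus the sum of all
  majorants. The constant stays outside the sum and is integrated only once.\<close>

lemma nn_integral_SUP_powr_mult_c: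
  "(\<integral>\<^sup>+w. (SUP n. ennreal (\<bar>centred (a n) w * real (c (b n) w) / lam (b n)\<bar> powr (1/2))) \<partial>M) < \<infinity>"
proof -
  have "(\<integral>\<^sup>+w. (SUP n. ennreal (\<bar>centred (a n) w * real (c (b n) w) / lam (b n)\<bar> powr (1/2))) \<partial>M)
      \<le> (\<integral>\<^sup>+w. 1 + (\<Sum>n. ennreal (majorant (a n) (b n) w)) \<partial>M)"
  proof (intro nn_integral_mono SUP_least)
    fix w n
    have "ennreal (\<bar>centred (a n) w * real (c (b n) w) / lam (b n)\<bar> powr (1/2)) \<le> ennreal (1 + majorant (a n) (b n) w)"
      using sqrt_abs_mult_c_le by (intro ennreal_leI) (simp add: powr_half_sqrt)
    also have "\<dots> = 1 + (\<Sum>i\<in>{n}. ennreal (majorant (a i) (b i) w))"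
      by (simp add: ennreal_plus)
    also have "\<dots> \<le> 1 + (\<Sum>i. ennreal (majorant (a i) (b i) w))"
      by (intro add_left_mono sum_le_suminf) auto
    finally show "ennreal (\<bar>centred (a n) w * real (c (b n) w) / lam (b n)\<bar> powr (1/2)) \<le>
        1 + (\<Sum>n. ennreal (majorant (a n) (b n) w))" .
  qed
  also have "\<dots> = 1 + (\<integral>\<^sup>+w. (\<Sum>n. ennreal (majorant (a n) (b n) w)) \<partial>M)"
    by (subst nn_integral_add) (auto simp: emeasure_space_1)
  also have "\<dots> < \<infinity>"
    using nn_integral_suminf_majorant by (simp add: ennreal_add_eq_top less_top)
  finally show ?thesis .
qed

end

end

section \<open>Choice of the intensities and conclusion\<close>

theorem mainTheorem2:
  "\<exists>(mu :: real measure) (M :: (nat \<Rightarrow> real) measure) (N :: (nat \<Rightarrow> real) \<Rightarrow> real measure)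
     (\<delta> :: real) (F :: nat \<Rightarrow> (nat \<Rightarrow> real) \<Rightarrow> real) (G :: nat \<Rightarrow> (nat \<Rightarrow> real) \<Rightarrow> real).
     poisson_process M mu N \<and> \<delta> > 0 \<and>
     (\<forall>n. F n \<in> poisson_process.T2 M mu N) \<and>
     (AE w in M. (\<lambda>n. F n w) \<longlonglongrightarrow> 0) \<and>
     (\<forall>n. integrable M (\<lambda>w. \<bar>F n w\<bar> powr (2 + \<delta>))) \<and>
     (\<lambda>n. \<integral>w. \<bar>F n w\<bar> powr (2 + \<delta>) \<partial>M) \<longlonglongrightarrow> 0 \<and>
     (\<integral>\<^sup>+w. (SUP n. ennreal (\<bar>F n w\<bar> powr \<delta>)) \<partial>M) < \<infinity> \<and>
     (\<forall>n. poisson_process.is_J1 M mu N (F n) (G n)) \<and>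
     \<not> (AE w in M. (\<lambda>n. G n w) \<longlonglongrightarrow> 0)"
proof -
  \<comment> \<open>The atoms at 2 n and 2 n + 1 play the roles of the n-th pair of sets: with m = n
    + 1, the even one has mass 1 / m and the odd one 1 / sqrt m.\<close>
  define lam :: "nat \<Rightarrow> real" where
    "lam i = (let m = real (Suc (i div 2)) in if even i then 1 / m else 1 / sqrt m)" for i
  define c :: "nat \<Rightarrow> (nat \<Rightarrow> real) \<Rightarrow> nat" where "c i w = nat \<lfloor>w i\<rfloor>" for i w
  define M where "M = PiM UNIV (\<lambda>i. distr (measure_pmf (poisson_pmf (lam i))) borel real)"
  have "indep_poisson M lam c"
    unfolding M_def c_def [abs_def] by (intro indep_poisson_PiM) (simp add: lam_def Let_def)
  then interpret indep_poisson M lam c .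
  define a b :: "nat \<Rightarrow> nat" where "a n = 2 * n" and "b n = Suc (2 * n)" for n
  have lam_a: "lam (a n) = 1 / real (Suc n)" and lam_b: "lam (b n) = 1 / sqrt (real (Suc n))" for n
    by (simp_all add: lam_def a_def b_def Let_def)
  have ne: "a n \<noteq> b n" for n by (simp add: a_def b_def)
  have le_1: "lam (a n) \<le> 1" "lam (b n) \<le> 1" for n by (simp_all add: lam_a lam_b)
  \<comment> \<open>As powers of n + 1, the rates reduce every estimate to adding exponents: -1 -
    1/4 = -5/4 and -2 + 1/2 = -3/2 lie below -1 and give summability, while -1 + 3/4 = -1/4 is
    negative and makes the moments of order 5/2 tend to 0.\<close>
  have lam_powr: "lam (a n) = real (Suc n) powr (-1)" "lam (b n) = real (Suc n) powr (-1/2)" for n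
    by (simp_all add: lam_a lam_b powr_minus_divide powr_half_sqrt)
  have summ: "summable (\<lambda>n. real (Suc n) powr s)" if "s < -1" for s
    using that summable_Suc_iff[of "\<lambda>n. real n powr s"] by (simp add: summable_real_powr_iff)
  have sm1: "summable (\<lambda>n. lam (a n) * sqrt (lam (b n)))"
  proof -
    have "lam (a n) * sqrt (lam (b n)) = real (Suc n) powr (-5/4)" for n
    proof -
      have "lam (a n) * sqrt (lam (b n)) = real (Suc n) powr (-1) * (real (Suc n) powr (-1/2)) powr (1/2)"
        unfolding lam_powr by (simp add: powr_half_sqrt del: of_nat_Suc)
      also have "\<dots> = real (Suc n) powr (-5/4)"
        unfolding powr_powr powr_add [symmetric] by simp
      finally show ?thesis .
    qed
    then show ?thesis using summ[of "-5/4"] by simp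
  qed
  have sm2: "summable (\<lambda>n. (lam (a n))\<^sup>2 * (lam (b n) + 1) / lam (b n))"
  proof (rule summable_comparison_test')
    \<comment> \<open>The factor 2 bounds \<open>lam (b n) + 1\<close>, the rates being at most
      1.\<close>
    show "summable (\<lambda>n. 2 * real (Suc n) powr (-3/2))"
      by (intro summable_mult summ) simp
    fix n :: nat
    have "(lam (a n))\<^sup>2 * (lam (b n) + 1) / lam (b n) \<le> (lam (a n))\<^sup>2 * 2 / lam (b n)"
      using le_1[of n] by (intro divide_right_mono mult_left_mono) auto
    also have "\<dots> = 2 * ((real (Suc n) powr (-1)) powr 2 / real (Suc n) powr (-1/2))"
      unfolding lam_powr by (simp add: powr_numeral)
    also have "\<dots> = 2 * real (Suc n) powr (-3/2)"
      unfolding powr_powr powr_diff [symmetric] by simp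
    finally show "norm ((lam (a n))\<^sup>2 * (lam (b n) + 1) / lam (b n)) \<le> 2 * real (Suc n) powr (-3/2)"
      by simp
  qed
  define F where "F n w = centred (a n) w * real (c (b n) w) / lam (b n)" for n w
  have "(\<lambda>n. \<integral>w. \<bar>F n w\<bar> powr (5/2) \<partial>M) \<longlonglongrightarrow> 0"
  proof (rule Lim_null_comparison[OF always_eventually])
    show "\<forall>n. norm (\<integral>w. \<bar>F n w\<bar> powr (5/2) \<partial>M) \<le> 30 * real (Suc n) powr (-1/4)"
    proof
      fix n
      have "(\<integral>w. \<bar>F n w\<bar> powr (5/2) \<partial>M) \<le> 30 * lam (a n) * lam (b n) powr (- 3/2)"
        unfolding F_def by (rule integral_powr_mult_c_le[OF ne le_1])
      also have "\<dots> = 30 * real (Suc n) powr (-1/4)"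
        unfolding lam_powr powr_powr mult.assoc powr_add [symmetric] by simp
      finally show "norm (\<integral>w. \<bar>F n w\<bar> powr (5/2) \<partial>M) \<le> 30 * real (Suc n) powr (-1/4)"
        by simp
    qed
    have "(\<lambda>n. real (Suc n) powr (-1/4)) \<longlonglongrightarrow> 0"
      by (intro tendsto_neg_powr filterlim_compose[OF filterlim_real_sequentially filterlim_Suc]) simp
    then show "(\<lambda>n. 30 * real (Suc n) powr (-1/4)) \<longlonglongrightarrow> 0"
      by (intro tendsto_mult_right_zero)
  qed
  moreover have "\<not> (AE w in M. (\<lambda>n. centred (a n) w) \<longlonglongrightarrow> 0)"
  proof (rule not_AE_centred_tendsto_0)
    show "inj a" by (auto simp: inj_def a_def)
    show "\<not> summable (\<lambda>n. lam (a n))"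
      unfolding lam_powr summable_Suc_iff[of "\<lambda>n. real n powr (-1)"] summable_real_powr_iff by simp
    show "(\<lambda>n. lam (a n)) \<longlonglongrightarrow> 0"
      unfolding lam_a using LIMSEQ_inverse_real_of_nat by (simp add: inverse_eq_divide)
  qed
  ultimately show ?thesis
    using poisson_process_axioms mult_c_in_T2[OF ne] is_J1_mult_c[OF ne]
      AE_mult_c_tendsto_0[OF ne sm1 sm2] nn_integral_SUP_powr_mult_c[OF ne sm1 sm2]
      integrable_powr_mult_c[OF ne le_1]
    by (intro exI[of _ "atoms lam"] exI[of _ M] exI[of _ proc] exI[of _ "1/2"] exI[of _ F]
        exI[of _ "\<lambda>n. centred (a n)"]) (simp add: F_def [abs_def])
qed

end
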